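(* Let $R$ and $S$ be regular $F$-finite rings of characteristic $p>0$, let $I$ be an ideal of $R$ and $J$ an ideal of $S$, and set $Q=R\otimes_{\mathbb F_p}S$. Let $\mathfrak A$ be the ideal of $Q$ generated by $\{f\otimes1,\ 1\otimes g: f\in I,g\in J\}$ and $\mathfrak M$ the ideal of $Q$ generated by $\{f\otimes g:f\in I,g\in J\}$. (1) $z\in\mathbb Z_p$ is a Bernstein-Sato root of $\mathfrak A$ if and only if $z=x+y$ where $x$ is a Bernstein-Sato root of $I$ and $y$ is a Bernstein-Sato root of $J$. (2) If $I$ is not contained in the nilradical of $R$ and $J$ is not contained in the nilradical of $S$, then the set of Bernstein-Sato roots of $\mathfrak M$ is the union of the set of Bernstein-Sato roots of $I$ and the set of Bernstein-Sato roots of $J$.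
   Context: A commutative ring $A$ of characteristic $p$ is $F$-finite if it is a finite module over $A^{p^e}=\{a^{p^e}:a\in A\}$ for every $e\in\mathbb N=\{0,1,\dots\}$. Put $D^e_A=\mathrm{End}_{A^{p^e}}(A)$. For an ideal $K$ of an $F$-finite ring $A$, let $D^e_A\cdot K^n$ be the ideal generated by all $\phi(g)$ with $\phi\in D^e_A$, $g\in K^n$, and $\mathcal B^\bullet_K(p^e)=\{n\in\mathbb N:D^e_A\cdot K^n\supsetneq D^e_A\cdot K^{n+1}\}$ (with $K^0=A$). A $p$-adic integer $x\in\mathbb Z_p$ is a Bernstein-Sato root of $K$ if it is the $p$-adic limit of a sequence $(\nu_e)_{e\in\mathbb N}$ with $\nu_e\in\mathcal B^\bullet_K(p^e)$. *)

theory Defs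
  imports
    "HOL-Algebra.Ideal_Product"
    "HOL-Algebra.Ring_Divisibility"
    "HOL-Algebra.Embedded_Algebras"
    "HOL-Algebra.Free_Abelian_Groups"
    "HOL-Number_Theory.Residues"
    "HOL-Library.Extended_Nat"
begin

section \<open>Regular rings and the nilradical\<close>

definition frac_rel :: "[('a, 'm) ring_scheme, 'a set] \<Rightarrow> (('a \<times> 'a) \<times> ('a \<times> 'a)) set" where
  "frac_rel A S = {((a, s), (b, t)). a \<in> carrier A \<and> b \<in> carrier A \<and> s \<in> S \<and> t \<in> S \<and>
     (\<exists>u\<in>S. u \<otimes>\<^bsub>A\<^esub> (a \<otimes>\<^bsub>A\<^esub> t) = u \<otimes>\<^bsub>A\<^esub> (b \<otimes>\<^bsub>A\<^esub> s))}"

text \<open>The ring of fractions \<open>S\<inverse>A\<close> for a submonoid \<open>S\<close> of \<open>(A, \<otimes>)\<close>; the fraction \<open>a/s\<close> is the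
  class \<open>frac_rel A S `` {(a, s)}\<close>.\<close>

definition localization :: "[('a, 'm) ring_scheme, 'a set] \<Rightarrow> ('a \<times> 'a) set ring" where
  "localization A S = \<lparr>
     carrier = (carrier A \<times> S) // frac_rel A S,
     monoid.mult = (\<lambda>U V. \<Union>{frac_rel A S `` {(a \<otimes>\<^bsub>A\<^esub> b, s \<otimes>\<^bsub>A\<^esub> t)} | a s b t.
              (a, s) \<in> U \<and> (b, t) \<in> V}),
     monoid.one = frac_rel A S `` {(\<one>\<^bsub>A\<^esub>, \<one>\<^bsub>A\<^esub>)},
     ring.zero = frac_rel A S `` {(\<zero>\<^bsub>A\<^esub>, \<one>\<^bsub>A\<^esub>)},
     ring.add = (\<lambda>U V. \<Union>{frac_rel A S `` {(a \<otimes>\<^bsub>A\<^esub> t \<oplus>\<^bsub>A\<^esub> b \<otimes>\<^bsub>A\<^esub> s, s \<otimes>\<^bsub>A\<^esub> t)} | a s b t.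
              (a, s) \<in> U \<and> (b, t) \<in> V})\<rparr>"

definition krull_dim :: "('a, 'm) ring_scheme \<Rightarrow> enat" where
  "krull_dim A = Sup {enat n | n. \<exists>P :: nat \<Rightarrow> 'a set.
     (\<forall>i\<le>n. primeideal (P i) A) \<and> (\<forall>i<n. P i \<subset> P (Suc i))}"

definition regular_local_ring :: "('a, 'm) ring_scheme \<Rightarrow> bool" where
  "regular_local_ring A \<longleftrightarrow> cring A \<and> noetherian_ring A \<and> (\<exists>!M. maximalideal M A) \<and>
     (\<exists>G. G \<subseteq> carrier A \<and> finite G \<and> enat (card G) = krull_dim A \<and> maximalideal (Idl\<^bsub>A\<^esub> G) A)"

definition regular_ring :: "('a, 'm) ring_scheme \<Rightarrow> bool" where
  "regular_ring A \<longleftrightarrow> cring A \<and> noetherian_ring A \<and>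
     (\<forall>P. primeideal P A \<longrightarrow> regular_local_ring (localization A (carrier A - P)))"

definition nilradical :: "('a, 'm) ring_scheme \<Rightarrow> 'a set" where
  "nilradical A = {a \<in> carrier A. \<exists>n::nat. a [^]\<^bsub>A\<^esub> n = \<zero>\<^bsub>A\<^esub>}"


section \<open>\<open>F\<close>-finite rings\<close>

definition has_characteristic :: "[('a, 'm) ring_scheme, nat] \<Rightarrow> bool" where
  "has_characteristic A p \<longleftrightarrow> (\<forall>n::nat. [n] \<cdot>\<^bsub>A\<^esub> \<one>\<^bsub>A\<^esub> = \<zero>\<^bsub>A\<^esub> \<longleftrightarrow> p dvd n)"

definition frob_powers :: "[nat, nat, ('a, 'm) ring_scheme] \<Rightarrow> 'a set" where
  "frob_powers p e A = (\<lambda>a. a [^]\<^bsub>A\<^esub> (p ^ e)) ` carrier A"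

text \<open>\<^const>\<open>ring.Span\<close> is meaningful for an arbitrary subring of scalars.\<close>

definition F_finite :: "[nat, ('a, 'm) ring_scheme] \<Rightarrow> bool" where
  "F_finite p A \<longleftrightarrow> cring A \<and> has_characteristic A p \<and>
     (\<forall>e. \<exists>Us. set Us \<subseteq> carrier A \<and> ring.Span A (frob_powers p e A) Us = carrier A)"


section \<open>Bernstein-Sato roots\<close>

definition linear_endos :: "[('a, 'm) ring_scheme, 'a set] \<Rightarrow> ('a \<Rightarrow> 'a) set" where
  "linear_endos A B = {\<phi> \<in> hom (add_monoid A) (add_monoid A).
     \<forall>b\<in>B. \<forall>x\<in>carrier A. \<phi> (b \<otimes>\<^bsub>A\<^esub> x) = b \<otimes>\<^bsub>A\<^esub> \<phi> x}"

definition diff_ops :: "[nat, nat, ('a, 'm) ring_scheme] \<Rightarrow> ('a \<Rightarrow> 'a) set" where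
  "diff_ops p e A = linear_endos A (frob_powers p e A)"

definition diff_ops_ideal :: "[nat, nat, ('a, 'm) ring_scheme, 'a set] \<Rightarrow> 'a set" where
  "diff_ops_ideal p e A K = Idl\<^bsub>A\<^esub> {\<phi> g | \<phi> g. \<phi> \<in> diff_ops p e A \<and> g \<in> K}"

text \<open>Powers in \<^const>\<open>ideals_set\<close> are the ideal powers, with \<open>K\<^sup>0 = A\<close>.\<close>

definition nu_invariants :: "[nat, ('a, 'm) ring_scheme, 'a set, nat] \<Rightarrow> nat set" where
  "nu_invariants p A K e = {n.
     diff_ops_ideal p e A (K [^]\<^bsub>ideals_set A\<^esub> (Suc n)) \<subset>
     diff_ops_ideal p e A (K [^]\<^bsub>ideals_set A\<^esub> n)}"

text \<open>\<open>\<int>\<^sub>p\<close> as the inverse limit of the rings \<open>\<int>/p\<^sup>k\<close>: a \<open>p\<close>-adic integer \<open>x\<close> is the sequence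
  of its canonical residues \<open>x k\<close> modulo \<open>p\<^sup>k\<close>.\<close>

definition padic_ints :: "nat \<Rightarrow> (nat \<Rightarrow> int) ring" where
  "padic_ints p = \<lparr>
     carrier = {x. (\<forall>k. x k \<in> {0..<int p ^ k}) \<and> (\<forall>k. x (Suc k) mod int p ^ k = x k)},
     monoid.mult = (\<lambda>x y k. (x k * y k) mod int p ^ k),
     monoid.one = (\<lambda>k. 1 mod int p ^ k),
     ring.zero = (\<lambda>k. 0),
     ring.add = (\<lambda>x y k. (x k + y k) mod int p ^ k)\<rparr>"

text \<open>\<open>p\<close>-adic convergence of a sequence of natural numbers: \<open>\<nu> e - x\<close> is eventually divisible by any
  given power of \<open>p\<close>.\<close>

definition padic_limit :: "[nat, nat \<Rightarrow> nat, nat \<Rightarrow> int] \<Rightarrow> bool" where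
  "padic_limit p \<nu> x \<longleftrightarrow> (\<forall>k. \<forall>\<^sub>F e in sequentially. int (\<nu> e) mod int p ^ k = x k)"

definition BS_roots :: "[nat, ('a, 'm) ring_scheme, 'a set] \<Rightarrow> (nat \<Rightarrow> int) set" where
  "BS_roots p A K = {x \<in> carrier (padic_ints p).
     \<exists>\<nu>. (\<forall>e. \<nu> e \<in> nu_invariants p A K e) \<and> padic_limit p \<nu> x}"


section \<open>Tensor products over \<open>\<bbbF>\<^sub>p\<close>\<close>

text \<open>The free abelian group on \<open>R \<times> S\<close> with the bilinear product determined by
  \<open>(r, s) (r', s') = (r r', s s')\<close>.\<close>

definition free_pair_ring ::
    "[('a, 'm) ring_scheme, ('b, 'n) ring_scheme] \<Rightarrow> ('a \<times> 'b \<Rightarrow>\<^sub>0 int) ring" where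
  "free_pair_ring R S = \<lparr>
     carrier = carrier (free_Abelian_group (carrier R \<times> carrier S)),
     monoid.mult = (\<lambda>x y. frag_extend (\<lambda>(r, s). frag_extend (\<lambda>(r', s').
               frag_of (r \<otimes>\<^bsub>R\<^esub> r', s \<otimes>\<^bsub>S\<^esub> s')) y) x),
     monoid.one = frag_of (\<one>\<^bsub>R\<^esub>, \<one>\<^bsub>S\<^esub>),
     ring.zero = 0,
     ring.add = (+)\<rparr>"

text \<open>The scalar multiplication of \<open>k \<in> \<bbbF>\<^sub>p\<close> on an \<open>\<bbbF>\<^sub>p\<close>-algebra is \<open>[k] \<cdot> r\<close>, where \<open>k\<close> is an integer
  representative.\<close>

definition tensor_relations ::
    "[nat, ('a, 'm) ring_scheme, ('b, 'n) ring_scheme] \<Rightarrow> ('a \<times> 'b \<Rightarrow>\<^sub>0 int) set" where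
  "tensor_relations p R S =
     {frag_of (r \<oplus>\<^bsub>R\<^esub> r', s) - frag_of (r, s) - frag_of (r', s) | r r' s.
        r \<in> carrier R \<and> r' \<in> carrier R \<and> s \<in> carrier S} \<union>
     {frag_of (r, s \<oplus>\<^bsub>S\<^esub> s') - frag_of (r, s) - frag_of (r, s') | r s s'.
        r \<in> carrier R \<and> s \<in> carrier S \<and> s' \<in> carrier S} \<union>
     {frag_of ([k] \<cdot>\<^bsub>R\<^esub> r, s) - frag_of (r, [k] \<cdot>\<^bsub>S\<^esub> s) | k r s.
        k \<in> carrier (residue_ring (int p)) \<and> r \<in> carrier R \<and> s \<in> carrier S}"

definition tensor_kernel ::
    "[nat, ('a, 'm) ring_scheme, ('b, 'n) ring_scheme] \<Rightarrow> ('a \<times> 'b \<Rightarrow>\<^sub>0 int) set" where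
  "tensor_kernel p R S =
     generate (free_Abelian_group (carrier R \<times> carrier S)) (tensor_relations p R S)"

definition tensor_ring ::
    "[nat, ('a, 'm) ring_scheme, ('b, 'n) ring_scheme] \<Rightarrow> ('a \<times> 'b \<Rightarrow>\<^sub>0 int) set ring" where
  "tensor_ring p R S = free_pair_ring R S Quot tensor_kernel p R S"

definition pure_tensor ::
    "[nat, ('a, 'm) ring_scheme, ('b, 'n) ring_scheme, 'a, 'b] \<Rightarrow> ('a \<times> 'b \<Rightarrow>\<^sub>0 int) set" where
  "pure_tensor p R S r s = tensor_kernel p R S +>\<^bsub>free_pair_ring R S\<^esub> frag_of (r, s)"

definition sum_ideal ::
    "[nat, ('a, 'm) ring_scheme, ('b, 'n) ring_scheme, 'a set, 'b set] \<Rightarrow>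
     ('a \<times> 'b \<Rightarrow>\<^sub>0 int) set set" where
  "sum_ideal p R S I J = Idl\<^bsub>tensor_ring p R S\<^esub>
     ({pure_tensor p R S f \<one>\<^bsub>S\<^esub> | f. f \<in> I} \<union> {pure_tensor p R S \<one>\<^bsub>R\<^esub> g | g. g \<in> J})"

definition product_ideal ::
    "[nat, ('a, 'm) ring_scheme, ('b, 'n) ring_scheme, 'a set, 'b set] \<Rightarrow>
     ('a \<times> 'b \<Rightarrow>\<^sub>0 int) set set" where
  "product_ideal p R S I J = Idl\<^bsub>tensor_ring p R S\<^esub>
     {pure_tensor p R S f g | f g. f \<in> I \<and> g \<in> J}"

end

theory Submission
  imports Defs
begin

text \<open>Everything reduces to linear algebra over \<open>\<bbbF>\<^sub>p\<close>. Contracting one tensor factor with a functional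
  turns a differential operator of level \<open>e\<close> on \<open>Q\<close> into one on the other factor. Comparing with
  a tensor of minimal length and with the operators \<open>\<alpha> \<otimes> \<beta>\<close>, this gives
  \<open>D\<^sub>Q (\<Sum> A\<^sub>i \<otimes> B\<^sub>i) = \<Sum> D\<^sub>R A\<^sub>i \<otimes> D\<^sub>S B\<^sub>i\<close> for ideals \<open>A\<^sub>i\<close>, \<open>B\<^sub>i\<close>. The powers of the two ideals are
  \<open>\<Sum> I\<^sup>i \<otimes> J\<^bsup>n-i\<^esup>\<close> and \<open>I\<^sup>n \<otimes> J\<^sup>n\<close>, and a filtration of a tensor product of vector spaces jumps exactly
  where both factors, respectively one of them, jump. Hence at every level \<open>e\<close> the set of
  \<open>\<nu>\<close>-invariants is the sumset, respectively the union, of those of \<open>I\<close> and \<open>J\<close>. These sets decrease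
  with \<open>e\<close>, so compactness of \<open>\<int>\<^sub>p\<close> carries both identities over to the limits.\<close>

text \<open>This notation makes every \<open>[k] \<cdot> x\<close> ambiguous.\<close>

no_notation ideal_prod (infixl "\<cdot>\<index>" 80)

section \<open>Additive maps and Frobenius\<close>

text \<open>Operators on \<open>Q\<close> are not decomposed into tensors of operators on the
  factors; only the ideals that they generate are compared. Both halves of the comparison rest on
  Frobenius. For x in \<open>R\<close>, \<open>x^(p^e) \<diamondop> 1\<close> is a p^e-th power in
  \<open>Q\<close>, so contracting an operator gives an operator on one factor. And Frobenius on
  \<open>Q\<close> is additive, so linearity of \<alpha> \<otimes> \<beta> can be checked against
  the p^e-th powers of pure tensors alone. Membership of \<open>n\<close> in a level set becomes a
  question about elements: since D (D K) \<subseteq> D K, a jump at \<open>n\<close> means that some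
  element of K^n lies outside D K^(n+1). The tensor of two such witnesses is separated from the next
  ideal by a functional. For the product ideal, a jump in one factor shows only if the same power of
  the other ideal is nonzero, which is where the nilradical comes in. The obstacle in the passage to
  limits is that a sequence of sums may converge while the summands do not.\<close>

lemma additive_mapD:
  assumes "ring A" "ring B" "f \<in> hom (add_monoid A) (add_monoid B)"
  shows "\<And>x. x \<in> carrier A \<Longrightarrow> f x \<in> carrier B"
    and "\<And>x y. x \<in> carrier A \<Longrightarrow> y \<in> carrier A \<Longrightarrow> f (x \<oplus>\<^bsub>A\<^esub> y) = f x \<oplus>\<^bsub>B\<^esub> f y"
    and "f \<zero>\<^bsub>A\<^esub> = \<zero>\<^bsub>B\<^esub>"
    and "\<And>x. x \<in> carrier A \<Longrightarrow> f (\<ominus>\<^bsub>A\<^esub> x) = \<ominus>\<^bsub>B\<^esub> f x"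
    and "\<And>x k. x \<in> carrier A \<Longrightarrow> f ([(k::int)] \<cdot>\<^bsub>A\<^esub> x) = [k] \<cdot>\<^bsub>B\<^esub> f x"
proof -
  interpret A: ring A by fact
  interpret B: ring B by fact
  interpret group_hom "add_monoid A" "add_monoid B" f
    using assms(3) by (simp add: group_hom_def group_hom_axioms_def A.add.is_group B.add.is_group)
  show "f x \<in> carrier B" if "x \<in> carrier A" for x using hom_closed that by simp
  show "f (x \<oplus>\<^bsub>A\<^esub> y) = f x \<oplus>\<^bsub>B\<^esub> f y" if "x \<in> carrier A" "y \<in> carrier A" for x y
    using hom_mult that by simp
  show "f \<zero>\<^bsub>A\<^esub> = \<zero>\<^bsub>B\<^esub>" using hom_one by simp
  show "f (\<ominus>\<^bsub>A\<^esub> x) = \<ominus>\<^bsub>B\<^esub> f x" if "x \<in> carrier A" for x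
    using hom_inv that by (simp add: a_inv_def)
  show "f ([(k::int)] \<cdot>\<^bsub>A\<^esub> x) = [k] \<cdot>\<^bsub>B\<^esub> f x" if "x \<in> carrier A" for x k
    using hom_int_pow that by (simp add: add_pow_def)
qed

lemma additive_mapI:
  assumes "\<And>x. x \<in> carrier A \<Longrightarrow> f x \<in> carrier B"
    and "\<And>x y. x \<in> carrier A \<Longrightarrow> y \<in> carrier A \<Longrightarrow> f (x \<oplus>\<^bsub>A\<^esub> y) = f x \<oplus>\<^bsub>B\<^esub> f y"
  shows "f \<in> hom (add_monoid A) (add_monoid B)"
  using assms by (auto simp: hom_def)

lemma (in ring) additive_subgroupI:
  assumes "H \<subseteq> carrier R" "\<zero> \<in> H" "\<And>x y. x \<in> H \<Longrightarrow> y \<in> H \<Longrightarrow> x \<oplus> y \<in> H"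
    "\<And>x. x \<in> H \<Longrightarrow> \<ominus> x \<in> H"
  shows "subgroup H (add_monoid R)"
  using assms by (auto intro!: subgroup.intro simp: a_inv_def)

text \<open>Inclusions of spans and ideals are obtained throughout by one device: the elements with
  the desired property form a subgroup that contains the generators. Most of these subgroups are
  preimages under an additive map.\<close>

lemma additive_vimage_subgroup:
  assumes "ring A" "ring B" "f \<in> hom (add_monoid A) (add_monoid B)" "subgroup H (add_monoid B)"
  shows "subgroup {x \<in> carrier A. f x \<in> H} (add_monoid A)"
proof -
  interpret A: ring A by fact
  note f = additive_mapD[OF assms(1,2,3)]
  show ?thesis
    by (rule A.additive_subgroupI)
      (use subgroup.one_closed[OF assms(4)] subgroup.m_closed[OF assms(4)]
        subgroup.m_inv_closed[OF assms(4)] in \<open>auto simp: f a_inv_def[of B]\<close>)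
qed

lemma additive_equalizer_subgroup:
  assumes "ring A" "ring B" "f \<in> hom (add_monoid A) (add_monoid B)" "g \<in> hom (add_monoid A) (add_monoid B)"
  shows "subgroup {x \<in> carrier A. f x = g x} (add_monoid A)"
proof -
  interpret A: ring A by fact
  note f = additive_mapD[OF assms(1,2,3)] and g = additive_mapD[OF assms(1,2,4)]
  show ?thesis by (rule A.additive_subgroupI) (auto simp: f g)
qed

lemma ideal_add_subgroup: "ideal K A \<Longrightarrow> subgroup K (add_monoid A)"
  by (rule additive_subgroup.a_subgroup[OF ideal.axioms(1)])

lemma ideal_prod_induct:
  assumes "x \<in> ideal_prod R A B" "subgroup H (add_monoid R)" "\<And>a b. a \<in> A \<Longrightarrow> b \<in> B \<Longrightarrow> a \<otimes>\<^bsub>R\<^esub> b \<in> H"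
  shows "x \<in> H"
  using assms(1) by induction (use assms(3) subgroup.m_closed[OF assms(2)] in auto)

lemma (in ring) zero_int_add_pow [simp]: "[(0::int)] \<cdot> x = \<zero>"
  by (simp add: add_pow_def)

lemma (in cring) ideal_from_subgroup:
  assumes "subgroup H (add_monoid R)" "\<And>r x. r \<in> carrier R \<Longrightarrow> x \<in> H \<Longrightarrow> r \<otimes> x \<in> H"
  shows "ideal H R"
proof (rule idealI[OF ring_axioms assms(1)])
  show "x \<otimes> a \<in> H" if "a \<in> H" "x \<in> carrier R" for a x using assms that by simp
  show "a \<otimes> x \<in> H" if "a \<in> H" "x \<in> carrier R" for a x
    using assms that subgroup.subset[OF assms(1)] m_comm[of a x] by auto
qed

section \<open>Binomial theorem and additivity of Frobenius\<close>

lemma (in cring) binomial: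
  assumes [simp]: "x \<in> carrier R" "y \<in> carrier R"
  shows "(x \<oplus> y) [^] (n::nat) = (\<Oplus>k\<in>{..n}. [(n choose k)] \<cdot> (x [^] k \<otimes> y [^] (n - k)))"
proof (induction n)
  case (Suc n)
  define T where "T m k = [(m choose k)] \<cdot> (x [^] k \<otimes> y [^] (m - k))" for m k :: nat
  have T[simp]: "T m k \<in> carrier R" for m k by (simp add: T_def)
  have T0: "T (Suc n) 0 = y \<otimes> T n 0"
    by (simp add: T_def m_comm)
  have TS: "T (Suc n) (Suc k) = x \<otimes> T n k \<oplus> y \<otimes> T n (Suc k)" if "k \<le> n" for k
  proof -
    have 1: "x \<otimes> T n k = [(n choose k)] \<cdot> (x [^] Suc k \<otimes> y [^] (n - k))"
      by (simp add: T_def add_pow_rdistr m_ac)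
    \<comment> \<open>At \<open>k = n\<close> the exponent \<open>n - Suc k\<close> is truncated,
      but the coefficient \<open>n choose Suc k\<close> is zero.\<close>
    have 2: "y \<otimes> T n (Suc k) = [(n choose Suc k)] \<cdot> (x [^] Suc k \<otimes> y [^] (n - k))"
    proof (cases "k = n")
      case False
      then have "n - k = Suc (n - Suc k)" using that by simp
      then show ?thesis by (simp add: T_def add_pow_rdistr m_ac)
    qed (simp add: T_def binomial_eq_0)
    show ?thesis unfolding 1 2 by (simp add: T_def add.nat_pow_mult)
  qed
  have "(x \<oplus> y) [^] Suc n = (\<Oplus>k\<in>{..n}. T n k) \<otimes> (x \<oplus> y)"
    using Suc by (simp add: T_def)
  \<comment> \<open>Lengthening only the second sum, by a zero term, lets the shift k \<mapsto> Suc
    k align it with the first; its term at 0 is split off.\<close>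
  also have "\<dots> = x \<otimes> (\<Oplus>k\<in>{..n}. T n k) \<oplus> y \<otimes> (\<Oplus>k\<in>{..Suc n}. T n k)"
  proof -
    have "T n (Suc n) = \<zero>" by (simp add: T_def binomial_eq_0)
    then have "(\<Oplus>k\<in>{..Suc n}. T n k) = (\<Oplus>k\<in>{..n}. T n k)" by simp
    then show ?thesis by (simp add: r_distr m_comm[of _ x] m_comm[of _ y])
  qed
  also have "\<dots> = (\<Oplus>k\<in>{..n}. x \<otimes> T n k) \<oplus> (\<Oplus>k\<in>{..Suc n}. y \<otimes> T n k)"
    by (simp add: finsum_rdistr del: finsum_Suc)
  also have "\<dots> = (\<Oplus>k\<in>{..n}. x \<otimes> T n k) \<oplus> ((\<Oplus>k\<in>{..n}. y \<otimes> T n (Suc k)) \<oplus> y \<otimes> T n 0)"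
    by (subst finsum_Suc2) auto
  also have "\<dots> = (\<Oplus>k\<in>{..n}. x \<otimes> T n k \<oplus> y \<otimes> T n (Suc k)) \<oplus> y \<otimes> T n 0"
    by (simp add: finsum_addf a_assoc Pi_def)
  also have "\<dots> = (\<Oplus>k\<in>{..n}. T (Suc n) (Suc k)) \<oplus> T (Suc n) 0"
    unfolding T0 by (intro arg_cong2[where f = "add R"] finsum_cong') (auto simp: TS)
  also have "\<dots> = (\<Oplus>k\<in>{..Suc n}. T (Suc n) k)"
    by (subst finsum_Suc2) auto
  finally show ?case unfolding T_def .
qed simp

lemma (in cring) char_add_pow:
  assumes "[p] \<cdot> \<one> = \<zero>" "p dvd n" "x \<in> carrier R"
  shows "[(n::nat)] \<cdot> x = \<zero>"
proof -
  obtain m where "n = p * m" using assms by blast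
  then have "[n] \<cdot> \<one> = \<zero>" using assms by (simp flip: add.nat_pow_pow)
  then show ?thesis using add_pow_ldistr[of \<one> x n] assms by simp
qed

lemma (in cring) frobenius_add:
  assumes "prime p" "[p] \<cdot> \<one> = \<zero>" and [simp]: "x \<in> carrier R" "y \<in> carrier R"
  shows "(x \<oplus> y) [^] (p::nat) = x [^] p \<oplus> y [^] p"
proof -
  define T where "T k = [(p choose k)] \<cdot> (x [^] k \<otimes> y [^] (p - k))" for k
  have T[simp]: "T k \<in> carrier R" for k by (simp add: T_def)
  have Tz: "T k = \<zero>" if "0 < k" "k < p" for k
    unfolding T_def using that assms by (intro char_add_pow[OF assms(2)] dvd_choose_prime) auto
  obtain m where m: "p = Suc m" using prime_gt_0_nat[OF \<open>prime p\<close>] gr0_implies_Suc by blast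
  have "(x \<oplus> y) [^] p = (\<Oplus>k\<in>{..Suc m}. T k)"
    unfolding T_def m[symmetric] by (rule binomial) simp_all
  also have "\<dots> = (\<Oplus>k\<in>{..m}. T k) \<oplus> T (Suc m)" by (simp add: a_comm)
  also have "(\<Oplus>k\<in>{..m}. T k) = (\<Oplus>k\<in>{0}. T k)"
    using m by (intro add.finprod_mono_neutral_cong_right) (auto intro: Tz)
  also have "\<dots> = T 0" by simp
  finally show ?thesis using m by (simp add: T_def a_comm)
qed

lemma (in cring) frobenius_pow_add:
  assumes "prime p" "[p] \<cdot> \<one> = \<zero>" "x \<in> carrier R" "y \<in> carrier R"
  shows "(x \<oplus> y) [^] ((p::nat) ^ e) = x [^] (p ^ e) \<oplus> y [^] (p ^ e)"
proof (induction e)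
  case (Suc e)
  have "z [^] (p ^ Suc e) = (z [^] (p ^ e)) [^] p" if "z \<in> carrier R" for z
    using that by (simp add: nat_pow_pow mult.commute)
  then show ?case using Suc assms frobenius_add[OF assms(1,2)] by simp
qed (use assms in simp)

section \<open>Functionals over the prime field\<close>

text \<open>Functionals to \<open>\<bbbF>\<^sub>p\<close> are represented by integer-valued maps that are additive modulo \<open>p\<close>.\<close>

definition fp_functional :: "[nat, ('a, 'm) ring_scheme, 'a \<Rightarrow> int] \<Rightarrow> bool" where
  "fp_functional p A l \<longleftrightarrow>
     (\<forall>x\<in>carrier A. \<forall>y\<in>carrier A. [l (x \<oplus>\<^bsub>A\<^esub> y) = l x + l y] (mod int p))"

text \<open>Values of functionals are integers that matter only modulo p. Where p kills the ring,
  their action as multiples sees no more than this, so the contractions below are well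
  defined.\<close>

lemma (in cring) char_int_pow_cong:
  assumes "[p] \<cdot> \<one> = \<zero>" "[j = k] (mod int p)" "x \<in> carrier R"
  shows "[j] \<cdot> x = [k] \<cdot> x"
proof -
  have pz: "[(int p * m)] \<cdot> x = \<zero>" for m
  proof -
    have "[int p] \<cdot> x = \<zero>"
      using char_add_pow[OF assms(1) dvd_refl assms(3)]
      by (simp add: add_pow_def int_pow_int)
    then show ?thesis using assms(3) by (simp flip: add.int_pow_pow)
  qed
  obtain m where m: "j = k + int p * m" using assms(2) by (metis cong_iff_lin cong_sym)
  show ?thesis using assms(3) pz[of m] by (simp add: m add.int_pow_mult)
qed

text \<open>Additive subgroups are F_p-subspaces here, and a subgroup \<open>M\<close> maximal among
  those that contain \<open>W\<close> and avoid \<open>x\<close> is a hyperplane complementary to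
  \<open>x\<close>: for y outside \<open>M\<close>, maximality puts x into M + Zy, and the
  coefficient of y can be inverted modulo p. The functional reads off the coefficient of
  \<open>x\<close>.\<close>

lemma (in cring) functional_exists:
  assumes p: "prime p" "[p] \<cdot> \<one> = \<zero>"
    and W: "subgroup W (add_monoid R)" and x: "x \<in> carrier R" "x \<notin> W"
  obtains l where "fp_functional p R l" "\<And>w. w \<in> W \<Longrightarrow> [l w = 0] (mod int p)" "[l x = 1] (mod int p)"
proof -
  define \<A> where "\<A> = {H. subgroup H (add_monoid R) \<and> W \<subseteq> H \<and> x \<notin> H}"
  have "\<exists>M\<in>\<A>. \<forall>X\<in>\<A>. M \<subseteq> X \<longrightarrow> X = M"
  proof (rule subset_Zorn_nonempty)
    show "\<A> \<noteq> {}" using W x unfolding \<A>_def by blast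
    fix \<C> assume ne: "\<C> \<noteq> {}" and ch: "subset.chain \<A> \<C>"
    have sub: "subgroup H (add_monoid R)" "W \<subseteq> H" "x \<notin> H" if "H \<in> \<C>" for H
      using that ch unfolding subset.chain_def \<A>_def by blast+
    have "subgroup (\<Union>\<C>) (add_monoid R)"
    proof (rule additive_subgroupI)
      show "\<Union>\<C> \<subseteq> carrier R"
      proof
        fix u assume "u \<in> \<Union>\<C>"
        then obtain H where "H \<in> \<C>" "u \<in> H" by blast
        then show "u \<in> carrier R" using subgroup.subset[OF sub(1)[of H]] by auto
      qed
      obtain H where "H \<in> \<C>" using ne by blast
      then show "\<zero> \<in> \<Union>\<C>" using subgroup.one_closed[OF sub(1)[of H]] by auto
    next
      fix u assume "u \<in> \<Union>\<C>"
      then obtain H where "H \<in> \<C>" "u \<in> H" by blast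
      then show "\<ominus> u \<in> \<Union>\<C>"
        using subgroup.m_inv_closed[OF sub(1)[of H], of u] unfolding a_inv_def by blast
    next
      fix u v assume "u \<in> \<Union>\<C>" "v \<in> \<Union>\<C>"
      then obtain H H' where H: "H \<in> \<C>" "H' \<in> \<C>" "u \<in> H" "v \<in> H'" by blast
      have "H \<subseteq> H' \<or> H' \<subseteq> H"
        using ch H(1,2) unfolding subset.chain_def by blast
      then obtain H'' where "H'' \<in> \<C>" "u \<in> H''" "v \<in> H''" using H by blast
      then show "u \<oplus> v \<in> \<Union>\<C>" using subgroup.m_closed[OF sub(1)[of H''], of u v] by auto
    qed
    moreover have "W \<subseteq> \<Union>\<C>" using ne sub(2) by blast
    moreover have "x \<notin> \<Union>\<C>" using sub(3) by blast
    ultimately show "\<Union>\<C> \<in> \<A>" unfolding \<A>_def by blast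
  qed
  then obtain M where M: "subgroup M (add_monoid R)" "W \<subseteq> M" "x \<notin> M"
    and max: "\<And>X. subgroup X (add_monoid R) \<Longrightarrow> M \<subseteq> X \<Longrightarrow> x \<notin> X \<Longrightarrow> X = M"
    unfolding \<A>_def by auto
  interpret M: subgroup M "add_monoid R" by fact
  have Mc: "m \<in> carrier R" if "m \<in> M" for m using that M.subset by auto
  have Madd: "u \<oplus> v \<in> M" if "u \<in> M" "v \<in> M" for u v using M.m_closed that by simp
  have Mneg: "\<ominus> u \<in> M" if "u \<in> M" for u using M.m_inv_closed that by (simp add: a_inv_def)
  have M0: "\<zero> \<in> M" using M.one_closed by simp
  have Mpow: "[(k::int)] \<cdot> u \<in> M" if "u \<in> M" for u k
    using add.subgroup_int_pow_closed[OF M(1) that, of k] by (simp add: add_pow_def)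
  have inv: "\<exists>j. [j * k = 1] (mod int p)" if "\<not> int p dvd k" for k
  proof -
    have "coprime k (int p)"
      using prime_imp_coprime[of "int p" k] that p(1) by (simp add: coprime_commute)
    then show ?thesis using cong_solve_coprime_int[of k "int p"] by (auto simp: mult.commute)
  qed
  have span: "\<exists>k. \<exists>m\<in>M. y = m \<oplus> [(k::int)] \<cdot> x" if y[simp]: "y \<in> carrier R" for y
  proof (cases "y \<in> M")
    case True
    then show ?thesis by (intro exI[of _ 0] bexI[of _ y]) simp_all
  next
    case False
    \<comment> \<open>\<open>M\<close> plus the multiples of \<open>y\<close> is strictly larger
      than \<open>M\<close>, so maximality forces it to contain \<open>x\<close>.\<close>
    let ?X = "{m \<oplus> [(k::int)] \<cdot> y | m k. m \<in> M}"
    have sX: "subgroup ?X (add_monoid R)"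
    proof (rule additive_subgroupI)
      show "?X \<subseteq> carrier R" using Mc by auto
      show "\<zero> \<in> ?X" using M0 by (intro CollectI exI[of _ \<zero>] exI[of _ 0]) simp
      fix u assume "u \<in> ?X"
      then obtain m k where u: "u = m \<oplus> [(k::int)] \<cdot> y" "m \<in> M" by blast
      have "\<ominus> u = \<ominus> m \<oplus> [(- k)] \<cdot> y" using u Mc by (simp add: minus_add add.int_pow_neg)
      then show "\<ominus> u \<in> ?X" using Mneg[OF u(2)] by blast
      fix v assume "v \<in> ?X"
      then obtain m' k' where v: "v = m' \<oplus> [(k'::int)] \<cdot> y" "m' \<in> M" by blast
      have "u \<oplus> v = (m \<oplus> m') \<oplus> [(k + k')] \<cdot> y"
        using u v Mc by (simp add: a_ac add.int_pow_mult)
      then show "u \<oplus> v \<in> ?X" using Madd[OF u(2) v(2)] by blast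
    qed
    have "M \<subseteq> ?X"
    proof
      fix m assume "m \<in> M"
      then show "m \<in> ?X" using Mc by (intro CollectI exI[of _ m] exI[of _ 0]) simp
    qed
    moreover have "y \<in> ?X"
      using M0 by (intro CollectI exI[of _ \<zero>] exI[of _ 1]) simp
    ultimately have "x \<in> ?X" using max[OF sX] False by blast
    then obtain m k where mk: "x = m \<oplus> [(k::int)] \<cdot> y" "m \<in> M" by blast
    have "\<not> int p dvd k"
    proof
      assume "int p dvd k"
      then have "[k] \<cdot> y = [(0::int)] \<cdot> y" by (intro char_int_pow_cong[OF p(2) _ y]) (simp add: cong_0_iff)
      then show False using mk Mc M(3) by simp
    qed
    then obtain j where j: "[j * k = 1] (mod int p)" using inv by blast
    have "[j] \<cdot> x = [j] \<cdot> m \<oplus> [(k * j)] \<cdot> y"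
      using mk Mc by (simp add: add.int_pow_distrib add.int_pow_pow)
    also have "[(k * j)] \<cdot> y = y"
      using char_int_pow_cong[OF p(2) j y] by (simp add: mult.commute)
    finally have "y = \<ominus> ([j] \<cdot> m) \<oplus> [j] \<cdot> x" using mk Mc y
      by (simp add: r_neg2 r_neg1)
    then show ?thesis using Mneg[OF Mpow[OF mk(2), of j]] by blast
  qed
  have uniq: "[k = k'] (mod int p)"
    if "m \<in> M" "m' \<in> M" "m \<oplus> [(k::int)] \<cdot> x = m' \<oplus> [(k'::int)] \<cdot> x" for m m' k k'
  proof (rule ccontr)
    assume "\<not> [k = k'] (mod int p)"
    then have "\<not> int p dvd (k - k')" by (simp add: cong_iff_dvd_diff)
    then obtain j where j: "[j * (k - k') = 1] (mod int p)" using inv by blast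
    have "[k] \<cdot> x = \<ominus> m \<oplus> (m \<oplus> [k] \<cdot> x)" using Mc that(1,2) x by (simp add: r_neg1)
    also have "\<dots> = (\<ominus> m \<oplus> m') \<oplus> [k'] \<cdot> x"
      unfolding that(3) using Mc that(1,2) x by (simp add: a_assoc)
    finally have "[(k - k')] \<cdot> x = ((\<ominus> m \<oplus> m') \<oplus> [k'] \<cdot> x) \<ominus> [k'] \<cdot> x"
      using x by (simp add: add.int_pow_diff a_minus_def)
    also have "\<dots> = \<ominus> m \<oplus> m'" using Mc that(1,2) x by (simp add: a_minus_def a_assoc r_neg)
    finally have "[(k - k')] \<cdot> x \<in> M" using Madd Mneg that by simp
    then have "[j] \<cdot> ([(k - k')] \<cdot> x) \<in> M" by (rule Mpow)
    moreover have "[j] \<cdot> ([(k - k')] \<cdot> x) = x"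
      using x char_int_pow_cong[OF p(2) j x(1)] by (simp add: add.int_pow_pow mult.commute)
    ultimately show False using M(3) by simp
  qed
  \<comment> \<open>The coefficient is an arbitrary choice; \<open>uniq\<close> determines its class
    modulo p, which is why additivity is claimed only as a congruence.\<close>
  define l where "l y = (SOME k. \<exists>m\<in>M. y = m \<oplus> [(k::int)] \<cdot> x)" for y
  have l: "\<exists>m\<in>M. y = m \<oplus> [l y] \<cdot> x" if "y \<in> carrier R" for y
    unfolding l_def using someI_ex[OF span[OF that]] .
  have lk: "[l y = k] (mod int p)" if "m \<in> M" "y = m \<oplus> [(k::int)] \<cdot> x" for y m k
    
  proof -
    have "y \<in> carrier R" using that x Mc by simp
    then obtain m' where "m' \<in> M" "y = m' \<oplus> [l y] \<cdot> x" using l[of y] by auto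
    then show ?thesis using uniq[of m' m "l y" k] that by simp
  qed
  show thesis
  proof
    show "fp_functional p R l"
      unfolding fp_functional_def
    proof (intro ballI)
      fix y z assume yz: "y \<in> carrier R" "z \<in> carrier R"
      obtain m m' where m: "m \<in> M" "m' \<in> M" "y = m \<oplus> [l y] \<cdot> x" "z = m' \<oplus> [l z] \<cdot> x"
        using l yz by meson
      have "(m \<oplus> [l y] \<cdot> x) \<oplus> (m' \<oplus> [l z] \<cdot> x) = (m \<oplus> m') \<oplus> [(l y + l z)] \<cdot> x"
        using m(1,2) Mc x by (simp add: a_ac add.int_pow_mult)
      then have "y \<oplus> z = (m \<oplus> m') \<oplus> [(l y + l z)] \<cdot> x" using m by simp
      then show "[l (y \<oplus> z) = l y + l z] (mod int p)" using lk[OF Madd[OF m(1,2)]] by blast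
    qed
    show "[l w = 0] (mod int p)" if "w \<in> W" for w
      using that M(2) Mc x by (intro lk[of w]) auto
    show "[l x = 1] (mod int p)"
      using M0 x by (intro lk[of \<zero>]) auto
  qed
qed

section \<open>Differential operators and \<open>\<nu>\<close>-invariants\<close>

lemma diff_opsD:
  assumes "\<phi> \<in> diff_ops p e A"
  shows "\<phi> \<in> hom (add_monoid A) (add_monoid A)"
    and "\<And>b x. b \<in> frob_powers p e A \<Longrightarrow> x \<in> carrier A \<Longrightarrow> \<phi> (b \<otimes>\<^bsub>A\<^esub> x) = b \<otimes>\<^bsub>A\<^esub> \<phi> x"
  using assms by (auto simp: diff_ops_def linear_endos_def)

lemma diff_opsI:
  assumes "\<phi> \<in> hom (add_monoid A) (add_monoid A)"
    and "\<And>b x. b \<in> frob_powers p e A \<Longrightarrow> x \<in> carrier A \<Longrightarrow> \<phi> (b \<otimes>\<^bsub>A\<^esub> x) = b \<otimes>\<^bsub>A\<^esub> \<phi> x"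
  shows "\<phi> \<in> diff_ops p e A"
  using assms by (auto simp: diff_ops_def linear_endos_def)

lemma ideal_power_0: "K [^]\<^bsub>ideals_set A\<^esub> (0::nat) = carrier A"
  by (simp add: nat_pow_def ideals_set_def)

lemma ideal_power_Suc:
  "K [^]\<^bsub>ideals_set A\<^esub> (Suc n) = ideal_prod A (K [^]\<^bsub>ideals_set A\<^esub> n) K"
  by (simp add: nat_pow_def ideals_set_def)

context cring
begin

lemma frob_powers_carrier: "frob_powers p e R \<subseteq> carrier R"
  by (auto simp: frob_powers_def)

lemma frob_powers_antimono:
  assumes "e \<le> e'" shows "frob_powers p e' R \<subseteq> frob_powers p e R"
proof
  fix b assume "b \<in> frob_powers p e' R"
  then obtain a where a: "a \<in> carrier R" "b = a [^] (p ^ e')" by (auto simp: frob_powers_def)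
  have "p ^ e' = p ^ (e' - e) * p ^ e" using assms by (simp flip: power_add)
  then have "b = (a [^] (p ^ (e' - e))) [^] (p ^ e)" using a by (simp add: nat_pow_pow)
  then show "b \<in> frob_powers p e R" using a unfolding frob_powers_def by blast
qed

lemma diff_ops_mono:
  assumes "e \<le> e'" shows "diff_ops p e R \<subseteq> diff_ops p e' R"
  using frob_powers_antimono[OF assms, of p] by (auto simp: diff_ops_def linear_endos_def)

lemma diff_ops_closed: "\<phi> \<in> diff_ops p e R \<Longrightarrow> x \<in> carrier R \<Longrightarrow> \<phi> x \<in> carrier R"
  using additive_mapD(1)[OF ring_axioms ring_axioms diff_opsD(1)] by blast

lemma diff_ops_id: "(\<lambda>x. x) \<in> diff_ops p e R"
  by (auto simp: diff_ops_def linear_endos_def hom_def)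

lemma diff_ops_comp:
  assumes "\<phi> \<in> diff_ops p e R" "\<psi> \<in> diff_ops p e R"
  shows "(\<lambda>x. \<phi> (\<psi> x)) \<in> diff_ops p e R"
proof (rule diff_opsI)
  note \<phi> = additive_mapD[OF ring_axioms ring_axioms diff_opsD(1)[OF assms(1)]]
  note \<psi> = additive_mapD[OF ring_axioms ring_axioms diff_opsD(1)[OF assms(2)]]
  show "(\<lambda>x. \<phi> (\<psi> x)) \<in> hom (add_monoid R) (add_monoid R)"
    by (rule additive_mapI) (simp_all add: \<phi> \<psi>)
  show "\<phi> (\<psi> (b \<otimes> x)) = b \<otimes> \<phi> (\<psi> x)" if "b \<in> frob_powers p e R" "x \<in> carrier R" for b x
    using that by (simp add: diff_opsD(2)[OF assms(1)] diff_opsD(2)[OF assms(2)] \<psi>)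
qed

lemma diff_ops_premult:
  assumes "\<phi> \<in> diff_ops p e R" "r \<in> carrier R"
  shows "(\<lambda>x. \<phi> (r \<otimes> x)) \<in> diff_ops p e R"
proof (rule diff_ops_comp[OF assms(1)], rule diff_opsI)
  show "(\<lambda>x. r \<otimes> x) \<in> hom (add_monoid R) (add_monoid R)"
    by (rule additive_mapI) (use assms in \<open>simp_all add: r_distr\<close>)
  show "r \<otimes> (b \<otimes> x) = b \<otimes> (r \<otimes> x)" if "b \<in> frob_powers p e R" "x \<in> carrier R" for b x
    using that assms frob_powers_carrier[of p e] m_lcomm[of r b x] by auto
qed

lemma diff_ops_ideal_ideal:
  assumes "K \<subseteq> carrier R" shows "ideal (diff_ops_ideal p e R K) R"
  unfolding diff_ops_ideal_def using assms diff_ops_closed by (intro genideal_ideal) blast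

lemma diff_ops_ideal_gen:
  assumes "K \<subseteq> carrier R" "\<phi> \<in> diff_ops p e R" "g \<in> K"
  shows "\<phi> g \<in> diff_ops_ideal p e R K"
proof -
  have "{\<phi> g | \<phi> g. \<phi> \<in> diff_ops p e R \<and> g \<in> K} \<subseteq> diff_ops_ideal p e R K"
    unfolding diff_ops_ideal_def using assms(1) diff_ops_closed by (intro genideal_self) blast
  then show ?thesis using assms by blast
qed

lemma diff_ops_ideal_minimal:
  assumes "ideal L R" "\<And>\<phi> g. \<phi> \<in> diff_ops p e R \<Longrightarrow> g \<in> K \<Longrightarrow> \<phi> g \<in> L"
  shows "diff_ops_ideal p e R K \<subseteq> L"
  unfolding diff_ops_ideal_def using assms by (intro genideal_minimal) auto

lemma diff_ops_ideal_subset: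
  assumes "K \<subseteq> carrier R" shows "K \<subseteq> diff_ops_ideal p e R K"
  using diff_ops_ideal_gen[OF assms diff_ops_id] by blast

lemma diff_ops_ideal_mono:
  assumes "e \<le> e'" "K \<subseteq> K'" "K' \<subseteq> carrier R"
  shows "diff_ops_ideal p e R K \<subseteq> diff_ops_ideal p e' R K'"
  using assms diff_ops_mono[OF assms(1), of p]
  by (intro diff_ops_ideal_minimal diff_ops_ideal_ideal diff_ops_ideal_gen) auto

text \<open>Operators of one level are closed under composition and under premultiplication by ring
  elements. So the elements that every operator sends into D K form an ideal, and it contains the
  generators \<open>\<phi> g\<close> of D K.\<close>

lemma diff_ops_ideal_idem:
  assumes K: "K \<subseteq> carrier R"
  shows "diff_ops_ideal p e R (diff_ops_ideal p e R K) \<subseteq> diff_ops_ideal p e R K"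
proof (rule diff_ops_ideal_minimal[OF diff_ops_ideal_ideal[OF K]])
  fix \<psi> x assume \<psi>: "\<psi> \<in> diff_ops p e R" and x: "x \<in> diff_ops_ideal p e R K"
  let ?D = "diff_ops_ideal p e R K"
  interpret D: ideal ?D R by (rule diff_ops_ideal_ideal[OF K])
  let ?H = "{y \<in> carrier R. \<forall>\<psi>\<in>diff_ops p e R. \<psi> y \<in> ?D}"
  note add = additive_mapD[OF ring_axioms ring_axioms diff_opsD(1)]
  have "ideal ?H R"
  proof (rule ideal_from_subgroup)
    show "subgroup ?H (add_monoid R)"
      by (rule additive_subgroupI) (auto simp: add)
    show "r \<otimes> y \<in> ?H" if "r \<in> carrier R" "y \<in> ?H" for r y
      using that diff_ops_premult[OF _ that(1)] by auto
  qed
  then have "?D \<subseteq> ?H"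
    using K by (intro diff_ops_ideal_minimal)
      (auto intro: diff_ops_closed diff_ops_ideal_gen[OF K diff_ops_comp])
  then show "\<psi> x \<in> ?D" using \<psi> x by blast
qed

section \<open>Ideal powers and the jumps of their filtration\<close>

lemma ideal_power_ideal:
  assumes "ideal K R" shows "ideal (K [^]\<^bsub>ideals_set R\<^esub> (n::nat)) R"
proof (induction n)
  case 0
  show ?case unfolding ideal_power_0 by (rule oneideal)
next
  case (Suc n)
  then show ?case unfolding ideal_power_Suc by (rule ideal_prod_is_ideal[OF _ assms])
qed

lemma ideal_power_carrier:
  assumes "ideal K R" shows "K [^]\<^bsub>ideals_set R\<^esub> (n::nat) \<subseteq> carrier R"
  using ideal.Icarr[OF ideal_power_ideal[OF assms]] by blast

lemma ideal_power_Suc_subset: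
  assumes "ideal K R" shows "K [^]\<^bsub>ideals_set R\<^esub> (Suc n) \<subseteq> K [^]\<^bsub>ideals_set R\<^esub> n"
  unfolding ideal_power_Suc using ideal_prod_inter[OF ideal_power_ideal[OF assms] assms] by blast

text \<open>Applying the operators to an inclusion of K^n in D K^(n+1) and using idempotence gives D
  K^n \<subseteq> D K^(n+1). A jump is therefore witnessed by one element of the power itself, which
  can be fed into tensors.\<close>

lemma nu_invariants_iff:
  assumes K: "ideal K R"
  shows "n \<in> nu_invariants p R K e \<longleftrightarrow>
    \<not> K [^]\<^bsub>ideals_set R\<^esub> n \<subseteq> diff_ops_ideal p e R (K [^]\<^bsub>ideals_set R\<^esub> (Suc n))"
proof -
  let ?K = "\<lambda>n. K [^]\<^bsub>ideals_set R\<^esub> (n::nat)"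
  let ?D = "\<lambda>n. diff_ops_ideal p e R (?K n)"
  note c = ideal_power_carrier[OF K]
  have 1: "?D (Suc n) \<subseteq> ?D n"
    by (rule diff_ops_ideal_mono[OF order_refl ideal_power_Suc_subset[OF K] c])
  have 2: "?K n \<subseteq> ?D n" by (rule diff_ops_ideal_subset[OF c])
  have 3: "?D n \<subseteq> ?D (Suc n)" if "?K n \<subseteq> ?D (Suc n)"
  proof -
    have "?D n \<subseteq> diff_ops_ideal p e R (?D (Suc n))"
      using ideal.Icarr[OF diff_ops_ideal_ideal[OF c]]
      by (intro diff_ops_ideal_mono[OF order_refl that]) blast
    then show ?thesis using diff_ops_ideal_idem[OF c] by blast
  qed
  show ?thesis unfolding nu_invariants_def using 1 2 3 by blast
qed

text \<open>Raising \<open>e\<close> enlarges the set of operators and with it D K^(n+1), while K^n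
  stays the same. This monotonicity is what allows limits to be tested level by level.\<close>

lemma nu_invariants_antimono:
  assumes K: "ideal K R" and "e \<le> e'"
  shows "nu_invariants p R K e' \<subseteq> nu_invariants p R K e"
proof
  fix n assume "n \<in> nu_invariants p R K e'"
  then show "n \<in> nu_invariants p R K e"
    unfolding nu_invariants_iff[OF K]
    using diff_ops_ideal_mono[OF assms(2) order_refl ideal_power_carrier[OF K, of "Suc n"], of p]
    by blast
qed

end

text \<open>Powers of a non-nilpotent element of \<open>K\<close> serve as the nonzero elements.
  This is the form in which the hypotheses on the nilradical enter part (2).\<close>

lemma (in cring) ideal_power_nonzero:
  assumes "ideal K R" "\<not> K \<subseteq> nilradical R"
  shows "\<exists>x\<in>K [^]\<^bsub>ideals_set R\<^esub> (n::nat). x \<noteq> \<zero>"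
proof -
  obtain g where g: "g \<in> K" "g \<notin> nilradical R" using assms(2) by blast
  then have gc: "g \<in> carrier R" using ideal.Icarr[OF assms(1)] by blast
  have "g [^] n \<in> K [^]\<^bsub>ideals_set R\<^esub> n"
  proof (induction n)
    case (Suc n)
    then show ?case unfolding ideal_power_Suc nat_pow_Suc using g(1) by (rule ideal_prod.prod)
  qed (simp only: ideal_power_0 nat_pow_0 one_closed)
  moreover have "g [^] n \<noteq> \<zero>" using g(2) gc by (auto simp: nilradical_def)
  ultimately show ?thesis by blast
qed

section \<open>Limits of \<open>\<nu>\<close>-invariants\<close>

text \<open>For a decreasing sequence of level sets, the limits are the points that every level set
  approximates at the matching precision, so sequences can be dispensed with.\<close>

definition level_roots :: "[nat, nat \<Rightarrow> nat set] \<Rightarrow> (nat \<Rightarrow> int) set" where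
  "level_roots p N = {x \<in> carrier (padic_ints p). \<forall>k. \<exists>n\<in>N k. int n mod int p ^ k = x k}"

lemma padic_ints_mod:
  assumes "x \<in> carrier (padic_ints p)" "k \<le> e" shows "x e mod int p ^ k = x k"
  using assms(2)
proof (induction e rule: dec_induct)
  case base
  then show ?case using assms(1) by (auto simp: padic_ints_def)
next
  case (step e)
  have "x (Suc e) mod int p ^ k = x (Suc e) mod int p ^ e mod int p ^ k"
    using step by (simp add: mod_mod_cancel le_imp_power_dvd)
  then show ?case using step assms(1) by (auto simp: padic_ints_def)
qed

text \<open>In one direction, some term \<open>\<nu> e\<close> with \<open>e \<ge> k\<close> has the
  right residue modulo p^k and, as the sets decrease, already belongs to level \<open>k\<close>. In
  the other, points chosen at each level form a convergent sequence because the residues of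
  \<open>x\<close> are compatible.\<close>

lemma BS_roots_eq_level_roots:
  assumes "cring A" "ideal K A"
  shows "BS_roots p A K = level_roots p (nu_invariants p A K)"
proof (intro equalityI subsetI)
  fix x assume "x \<in> BS_roots p A K"
  then obtain \<nu> where x: "x \<in> carrier (padic_ints p)"
    and \<nu>: "\<And>e. \<nu> e \<in> nu_invariants p A K e" "padic_limit p \<nu> x"
    by (auto simp: BS_roots_def)
  have "\<exists>n\<in>nu_invariants p A K k. int n mod int p ^ k = x k" for k
  proof -
    obtain e where "k \<le> e" "int (\<nu> e) mod int p ^ k = x k"
      using \<nu>(2) unfolding padic_limit_def eventually_sequentially by (meson linear)
    then show ?thesis using \<nu>(1) cring.nu_invariants_antimono[OF assms, of k e] by blast
  qed
  then show "x \<in> level_roots p (nu_invariants p A K)" using x by (simp add: level_roots_def)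
next
  fix x assume "x \<in> level_roots p (nu_invariants p A K)"
  then obtain \<nu> where x: "x \<in> carrier (padic_ints p)"
    and \<nu>: "\<And>k. \<nu> k \<in> nu_invariants p A K k" "\<And>k. int (\<nu> k) mod int p ^ k = x k"
    unfolding level_roots_def by (auto simp: Bex_def) metis
  have "padic_limit p \<nu> x"
    unfolding padic_limit_def eventually_sequentially
  proof (intro allI exI impI)
    fix k e :: nat assume "k \<le> e"
    then have "int (\<nu> e) mod int p ^ k = int (\<nu> e) mod int p ^ e mod int p ^ k"
      by (simp add: mod_mod_cancel le_imp_power_dvd)
    then show "int (\<nu> e) mod int p ^ k = x k"
      using \<nu>(2) padic_ints_mod[OF x \<open>k \<le> e\<close>] by simp
  qed
  then show "x \<in> BS_roots p A K" using x \<nu>(1) by (auto simp: BS_roots_def)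
qed

text \<open>If the points of \<open>N j\<close> miss \<open>x\<close> at precision \<open>j\<close>
  and those of \<open>M k\<close> miss it at precision \<open>k\<close>, a point at level
  \<open>max j k\<close> contradicts one of the two: it lies in the earlier level and approximates
  \<open>x\<close> at every lower precision.\<close>

lemma level_roots_Un:
  assumes N: "\<And>e e'. e \<le> e' \<Longrightarrow> N e' \<subseteq> N e" and M: "\<And>e e'. e \<le> e' \<Longrightarrow> M e' \<subseteq> M e"
  shows "level_roots p (\<lambda>e. N e \<union> M e) = level_roots p N \<union> level_roots p M"
proof (intro equalityI subsetI)
  fix x assume x: "x \<in> level_roots p (\<lambda>e. N e \<union> M e)"
  then have xc: "x \<in> carrier (padic_ints p)" by (simp add: level_roots_def)
  show "x \<in> level_roots p N \<union> level_roots p M"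
  proof (rule ccontr)
    assume "x \<notin> level_roots p N \<union> level_roots p M"
    then obtain j k where jk: "\<And>n. n \<in> N j \<Longrightarrow> int n mod int p ^ j \<noteq> x j"
      "\<And>n. n \<in> M k \<Longrightarrow> int n mod int p ^ k \<noteq> x k"
      using xc by (auto simp: level_roots_def)
    obtain n where n: "n \<in> N (max j k) \<union> M (max j k)" "int n mod int p ^ max j k = x (max j k)"
      using x unfolding level_roots_def by blast
    have "int n mod int p ^ i = x i" if "i \<le> max j k" for i
      using padic_ints_mod[OF xc that] n(2) that
      by (metis le_imp_power_dvd mod_mod_cancel)
    then have "int n mod int p ^ j = x j" "int n mod int p ^ k = x k" by simp_all
    then show False using jk[of n] n(1) N[of j "max j k"] M[of k "max j k"] by auto
  qed
qed (auto simp: level_roots_def)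

text \<open>Compactness of Z_p by repeated pigeonhole: among infinitely many indices with a common
  residue modulo p^k, infinitely many share a residue modulo p^(k+1). Having infinitely many hits
  leaves room to choose an index beyond any bound.\<close>

lemma padic_accumulation_point:
  fixes n :: "nat \<Rightarrow> nat"
  assumes "p > 0"
  obtains x where "x \<in> carrier (padic_ints p)" "\<And>k. infinite {i. int (n i) mod int p ^ k = x k}"
proof -
  have "\<exists>x. \<forall>k. infinite {i. int (n i) mod int p ^ k = x k} \<and> x (Suc k) mod int p ^ k = x k"
  proof (rule dependent_nat_choice)
    show "\<exists>a. infinite {i. int (n i) mod int p ^ 0 = a}"
      by (rule exI[of _ 0]) (simp add: infinite_UNIV_nat)
    fix a k assume a: "infinite {i. int (n i) mod int p ^ k = a}"
    let ?f = "\<lambda>i. int (n i) mod int p ^ Suc k" and ?A = "{i. int (n i) mod int p ^ k = a}"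
    have "?f ` ?A \<subseteq> {0..<int p ^ Suc k}" using assms by auto
    then have "finite (?f ` ?A)" by (rule finite_subset) simp
    then obtain i where i: "i \<in> ?A" "infinite {j \<in> ?A. ?f j = ?f i}"
      using pigeonhole_infinite[OF a] by blast
    have "{j \<in> ?A. ?f j = ?f i} \<subseteq> {j. ?f j = ?f i}" by blast
    then have "infinite {j. ?f j = ?f i}" using i(2) finite_subset by blast
    moreover have "?f i mod int p ^ k = a" using i(1) by (simp add: mod_mod_cancel)
    ultimately show "\<exists>b. infinite {i. int (n i) mod int p ^ Suc k = b} \<and> b mod int p ^ k = a"
      by blast
  qed
  then obtain x where x: "\<And>k. infinite {i. int (n i) mod int p ^ k = x k}"
    "\<And>k. x (Suc k) mod int p ^ k = x k" by blast
  have "x k \<in> {0..<int p ^ k}" for k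
  proof -
    obtain i where "int (n i) mod int p ^ k = x k"
      using x(1)[of k] not_finite_existsD by blast
    then have "x k = int (n i) mod int p ^ k" by simp
    then show ?thesis using assms by simp
  qed
  then have "x \<in> carrier (padic_ints p)" using x(2) by (simp add: padic_ints_def)
  then show thesis using that x(1) by blast
qed

lemma level_roots_sum:
  assumes "p > 0"
    and N: "\<And>e e'. e \<le> e' \<Longrightarrow> N e' \<subseteq> N e" and M: "\<And>e e'. e \<le> e' \<Longrightarrow> M e' \<subseteq> M e"
    and z: "z \<in> carrier (padic_ints p)"
  shows "z \<in> level_roots p (\<lambda>e. {n + m | n m. n \<in> N e \<and> m \<in> M e}) \<longleftrightarrow>
    (\<exists>x\<in>level_roots p N. \<exists>y\<in>level_roots p M. z = x \<oplus>\<^bsub>padic_ints p\<^esub> y)"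
proof
  assume "z \<in> level_roots p (\<lambda>e. {n + m | n m. n \<in> N e \<and> m \<in> M e})"
  then have "\<forall>k. \<exists>n m. n \<in> N k \<and> m \<in> M k \<and> int (n + m) mod int p ^ k = z k"
    unfolding level_roots_def by blast
  then obtain n m where n: "\<And>k. n k \<in> N k" and m: "\<And>k. m k \<in> M k"
    and nm: "\<And>k. int (n k + m k) mod int p ^ k = z k" by metis
  obtain x where x: "x \<in> carrier (padic_ints p)"
    and inf: "\<And>k. infinite {i. int (n i) mod int p ^ k = x k}"
    using padic_accumulation_point[OF assms(1)] by blast
  \<comment> \<open>Only the first summands are made to accumulate; the second limit is then forced
    to be z - x.\<close>
  define y where "y k = (z k - x k) mod int p ^ k" for k
  have y: "y \<in> carrier (padic_ints p)"
  proof -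
    have "y (Suc k) mod int p ^ k = y k" for k
    proof -
      have "y (Suc k) mod int p ^ k = (z (Suc k) - x (Suc k)) mod int p ^ k"
        by (simp add: y_def mod_mod_cancel)
      also have "\<dots> = (z (Suc k) mod int p ^ k - x (Suc k) mod int p ^ k) mod int p ^ k"
        by (simp add: mod_diff_eq)
      finally show ?thesis using padic_ints_mod[OF x, of k "Suc k"] padic_ints_mod[OF z, of k "Suc k"]
        by (simp add: y_def)
    qed
    then show ?thesis using assms(1) by (auto simp: padic_ints_def y_def)
  qed
  \<comment> \<open>The bound \<open>i \<ge> k\<close> does two things: it places \<open>n i\<close>
    and \<open>m i\<close> in the levels \<open>N k\<close> and \<open>M k\<close>, and it makes
    \<open>n i + m i\<close> agree with \<open>z\<close> modulo p^k.\<close>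
  have near: "\<exists>i\<ge>k. int (n i) mod int p ^ k = x k \<and> int (m i) mod int p ^ k = y k" for k
  proof -
    obtain i where i: "k \<le> i" "int (n i) mod int p ^ k = x k"
      using inf[of k] by (auto simp: infinite_nat_iff_unbounded_le)
    have "int (n i + m i) mod int p ^ k = z k"
      using padic_ints_mod[OF z i(1)] nm[of i] i(1) by (metis le_imp_power_dvd mod_mod_cancel)
    then have "y k = (int (n i + m i) mod int p ^ k - int (n i) mod int p ^ k) mod int p ^ k"
      using i(2) by (simp add: y_def)
    also have "\<dots> = int (m i) mod int p ^ k" by (simp add: mod_diff_eq)
    finally show ?thesis using i by auto
  qed
  have "x \<in> level_roots p N" "y \<in> level_roots p M"
    unfolding level_roots_def using x y near n m N M by (blast, blast)
  moreover have "z = x \<oplus>\<^bsub>padic_ints p\<^esub> y"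
  proof
    fix k
    have "(x \<oplus>\<^bsub>padic_ints p\<^esub> y) k = z k mod int p ^ k"
      by (simp add: padic_ints_def y_def mod_add_right_eq)
    then show "z k = (x \<oplus>\<^bsub>padic_ints p\<^esub> y) k" using z by (auto simp: padic_ints_def)
  qed
  ultimately show "\<exists>x\<in>level_roots p N. \<exists>y\<in>level_roots p M. z = x \<oplus>\<^bsub>padic_ints p\<^esub> y" by blast
next
  assume "\<exists>x\<in>level_roots p N. \<exists>y\<in>level_roots p M. z = x \<oplus>\<^bsub>padic_ints p\<^esub> y"
  then obtain x y where x: "x \<in> level_roots p N" and y: "y \<in> level_roots p M"
    and xy: "z = x \<oplus>\<^bsub>padic_ints p\<^esub> y" by blast
  have "\<exists>l\<in>{n + m | n m. n \<in> N k \<and> m \<in> M k}. int l mod int p ^ k = z k" for k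
  proof -
    obtain n m where nm: "n \<in> N k" "int n mod int p ^ k = x k" "m \<in> M k" "int m mod int p ^ k = y k"
      using x y unfolding level_roots_def by blast
    have "int (n + m) mod int p ^ k = (int n mod int p ^ k + int m mod int p ^ k) mod int p ^ k"
      by (simp add: mod_add_eq)
    also have "\<dots> = z k" by (simp add: xy padic_ints_def nm)
    finally show ?thesis using nm by blast
  qed
  then show "z \<in> level_roots p (\<lambda>e. {n + m | n m. n \<in> N e \<and> m \<in> M e})"
    using z by (simp add: level_roots_def)
qed

section \<open>The tensor product over the prime field\<close>

lemma frag_cmul_diff: "frag_cmul c (a - b) = frag_cmul c a - frag_cmul c b"
  by (rule poly_mapping_eqI) (simp add: lookup_minus algebra_simps)

lemma frag_extend_fun_diff:
  "frag_extend (\<lambda>i. f i - g i) x = frag_extend f x - frag_extend g x"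
  by (simp add: frag_extend_def frag_cmul_diff sum_subtractf)

locale tensor =
  fixes p :: nat and R :: "('a, 'm) ring_scheme" and S :: "('b, 'n) ring_scheme"
  assumes p: "prime p" and R: "cring R" and S: "cring S"
    and char_R: "[p] \<cdot>\<^bsub>R\<^esub> \<one>\<^bsub>R\<^esub> = \<zero>\<^bsub>R\<^esub>" and char_S: "[p] \<cdot>\<^bsub>S\<^esub> \<one>\<^bsub>S\<^esub> = \<zero>\<^bsub>S\<^esub>"
begin

sublocale R: cring R by (rule R)
sublocale S: cring S by (rule S)

abbreviation "X \<equiv> carrier R \<times> carrier S"
abbreviation "F \<equiv> free_pair_ring R S"
abbreviation "K \<equiv> tensor_kernel p R S"
abbreviation "Q \<equiv> tensor_ring p R S"
abbreviation pure (infixl "\<diamondop>" 75) where "r \<diamondop> s \<equiv> pure_tensor p R S r s"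

section \<open>The free ring on pairs and the ideal of tensor relations\<close>

lemma add_monoid_F: "add_monoid F = free_Abelian_group X"
  by (simp add: free_pair_ring_def free_Abelian_group_def)

lemma F_simps [simp]:
  "x \<in> carrier F \<longleftrightarrow> Poly_Mapping.keys x \<subseteq> X" "x \<oplus>\<^bsub>F\<^esub> y = x + y"
  "\<one>\<^bsub>F\<^esub> = frag_of (\<one>\<^bsub>R\<^esub>, \<one>\<^bsub>S\<^esub>)"
  by (simp_all add: free_pair_ring_def)

lemma F_zero: "\<zero>\<^bsub>F\<^esub> = 0"
  by (simp add: free_pair_ring_def)

lemma F_mult:
  "x \<otimes>\<^bsub>F\<^esub> y = frag_extend (\<lambda>(r, s). frag_extend (\<lambda>(r', s'). frag_of (r \<otimes>\<^bsub>R\<^esub> r', s \<otimes>\<^bsub>S\<^esub> s')) y) x"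
  by (simp add: free_pair_ring_def)

text \<open>Stated for differences because induction on the free Abelian group passes through
  differences; the laws for sums are derived from these.\<close>

lemma F_mult_diff:
  "(x - y) \<otimes>\<^bsub>F\<^esub> z = x \<otimes>\<^bsub>F\<^esub> z - y \<otimes>\<^bsub>F\<^esub> z" "x \<otimes>\<^bsub>F\<^esub> (y - z) = x \<otimes>\<^bsub>F\<^esub> y - x \<otimes>\<^bsub>F\<^esub> z"
  "0 \<otimes>\<^bsub>F\<^esub> z = 0" "x \<otimes>\<^bsub>F\<^esub> 0 = 0"
proof -
  show "(x - y) \<otimes>\<^bsub>F\<^esub> z = x \<otimes>\<^bsub>F\<^esub> z - y \<otimes>\<^bsub>F\<^esub> z" by (simp add: F_mult frag_extend_diff)
  show 2: "x \<otimes>\<^bsub>F\<^esub> (y - z) = x \<otimes>\<^bsub>F\<^esub> y - x \<otimes>\<^bsub>F\<^esub> z" for x y z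
    by (simp add: F_mult frag_extend_diff split_def frag_extend_fun_diff)
  show "0 \<otimes>\<^bsub>F\<^esub> z = 0" by (simp add: F_mult)
  show "x \<otimes>\<^bsub>F\<^esub> 0 = 0" using 2[of x 0 0] by simp
qed

lemma F_mult_of [simp]:
  "frag_of (r, s) \<otimes>\<^bsub>F\<^esub> frag_of (r', s') = frag_of (r \<otimes>\<^bsub>R\<^esub> r', s \<otimes>\<^bsub>S\<^esub> s')"
  by (simp add: F_mult)

lemma F_mult_add:
  "(x + y) \<otimes>\<^bsub>F\<^esub> z = x \<otimes>\<^bsub>F\<^esub> z + y \<otimes>\<^bsub>F\<^esub> z" "x \<otimes>\<^bsub>F\<^esub> (y + z) = x \<otimes>\<^bsub>F\<^esub> y + x \<otimes>\<^bsub>F\<^esub> z"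
  using F_mult_diff(1)[of "x + y" y z] F_mult_diff(2)[of x "y + z" z] by simp_all

lemma F_induct [consumes 1, case_names zero diff frag_of]:
  assumes "Poly_Mapping.keys x \<subseteq> X" "P 0"
    "\<And>x y. \<lbrakk>Poly_Mapping.keys x \<subseteq> X; Poly_Mapping.keys y \<subseteq> X; P x; P y\<rbrakk> \<Longrightarrow> P (x - y)"
    "\<And>r s. r \<in> carrier R \<Longrightarrow> s \<in> carrier S \<Longrightarrow> P (frag_of (r, s))"
  shows "P x"
  using assms by (intro free_Abelian_group_induct[of x X P]) auto

lemma F_mult_closed:
  assumes "Poly_Mapping.keys x \<subseteq> X" "Poly_Mapping.keys y \<subseteq> X"
  shows "Poly_Mapping.keys (x \<otimes>\<^bsub>F\<^esub> y) \<subseteq> X"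
  using assms(1)
proof (induction x rule: F_induct)
  case (frag_of r s)
  from assms(2) show ?case
  proof (induction y rule: F_induct)
    case (diff x y)
    then show ?case
      using keys_diff[of "frag_of (r, s) \<otimes>\<^bsub>F\<^esub> x" "frag_of (r, s) \<otimes>\<^bsub>F\<^esub> y"] by (auto simp: F_mult_diff)
  qed (use frag_of in \<open>simp_all add: F_mult_diff\<close>)
next
  case (diff x x')
  then show ?case using keys_diff[of "x \<otimes>\<^bsub>F\<^esub> y" "x' \<otimes>\<^bsub>F\<^esub> y"] by (auto simp: F_mult_diff)
qed (simp add: F_mult_diff)

text \<open>Commutativity, associativity and the unit law are additive in each variable, so they can
  be tested on basis elements, where they reduce to the laws of \<open>R\<close> and
  \<open>S\<close>.\<close>

lemma F_cring: "cring F"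
proof (rule cringI)
  show "abelian_group F"
  proof (rule abelian_groupI)
    show "x \<oplus>\<^bsub>F\<^esub> y \<in> carrier F" if "x \<in> carrier F" "y \<in> carrier F" for x y
      using that keys_add[of x y] by auto
    show "\<exists>y\<in>carrier F. y \<oplus>\<^bsub>F\<^esub> x = \<zero>\<^bsub>F\<^esub>" if "x \<in> carrier F" for x
      using that by (intro bexI[of _ "- x"]) (auto simp: F_zero)
  qed (auto simp: algebra_simps F_zero)
  show "comm_monoid F"
  proof (rule comm_monoidI)
    fix x y z assume "x \<in> carrier F" "y \<in> carrier F" "z \<in> carrier F"
    then have x: "Poly_Mapping.keys x \<subseteq> X" and y: "Poly_Mapping.keys y \<subseteq> X"
      and z: "Poly_Mapping.keys z \<subseteq> X" by auto
    show "x \<otimes>\<^bsub>F\<^esub> y \<in> carrier F" using F_mult_closed x y by simp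
    show "\<one>\<^bsub>F\<^esub> \<otimes>\<^bsub>F\<^esub> x = x"
      using x by (induction x rule: F_induct) (simp_all add: F_mult_diff)
    show "x \<otimes>\<^bsub>F\<^esub> y = y \<otimes>\<^bsub>F\<^esub> x"
      using x
    proof (induction x rule: F_induct)
      case (frag_of r s)
      from y show ?case
        by (induction y rule: F_induct) (use frag_of in \<open>simp_all add: F_mult_diff R.m_comm S.m_comm\<close>)
    qed (simp_all add: F_mult_diff)
    show "x \<otimes>\<^bsub>F\<^esub> y \<otimes>\<^bsub>F\<^esub> z = x \<otimes>\<^bsub>F\<^esub> (y \<otimes>\<^bsub>F\<^esub> z)"
      using x
    proof (induction x rule: F_induct)
      case (frag_of r s)
      from y show ?case
      proof (induction y rule: F_induct)
        case (frag_of r' s')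
        from z show ?case
          by (induction z rule: F_induct)
            (use frag_of \<open>r \<in> carrier R\<close> \<open>s \<in> carrier S\<close> in \<open>simp_all add: F_mult_diff R.m_assoc S.m_assoc\<close>)
      qed (simp_all add: F_mult_diff)
    qed (simp_all add: F_mult_diff)
  qed auto
  show "(x \<oplus>\<^bsub>F\<^esub> y) \<otimes>\<^bsub>F\<^esub> z = x \<otimes>\<^bsub>F\<^esub> z \<oplus>\<^bsub>F\<^esub> y \<otimes>\<^bsub>F\<^esub> z" for x y z by (simp add: F_mult_add)
qed

sublocale F: cring F by (rule F_cring)

lemma F_minus: "Poly_Mapping.keys x \<subseteq> X \<Longrightarrow> Poly_Mapping.keys y \<subseteq> X \<Longrightarrow> x \<ominus>\<^bsub>F\<^esub> y = x - y"
  unfolding a_minus_def a_inv_def add_monoid_F by simp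

lemma tensor_relations_carrier: "tensor_relations p R S \<subseteq> carrier (free_Abelian_group X)"
proof -
  have k: "Poly_Mapping.keys (x - y) \<subseteq> X" if "Poly_Mapping.keys x \<subseteq> X" "Poly_Mapping.keys y \<subseteq> X" for x y
    using that keys_diff[of x y] by blast
  show ?thesis
  proof
    fix x assume "x \<in> tensor_relations p R S"
    then show "x \<in> carrier (free_Abelian_group X)"
      unfolding tensor_relations_def by (elim UnE CollectE exE conjE) (simp_all add: k)
  qed
qed

lemma K_subgroup: "subgroup K (add_monoid F)"
  unfolding add_monoid_F tensor_kernel_def
  by (rule group.generate_is_subgroup[OF group_free_Abelian_group tensor_relations_carrier])

lemma K_carrier: "x \<in> K \<Longrightarrow> Poly_Mapping.keys x \<subseteq> X"
  using subsetD[OF subgroup.subset[OF K_subgroup], of x] by simp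

lemma K_zero: "0 \<in> K"
  using subgroup.one_closed[OF K_subgroup] by (simp add: F_zero)

lemma K_diff: "x \<in> K \<Longrightarrow> y \<in> K \<Longrightarrow> x - y \<in> K"
  using subgroup.m_closed[OF K_subgroup[unfolded add_monoid_F], of x "- y"]
    subgroup.m_inv_closed[OF K_subgroup[unfolded add_monoid_F], of y]
    inv_free_Abelian_group[OF K_carrier, of y]
  by simp

lemma K_relation: "x \<in> tensor_relations p R S \<Longrightarrow> x \<in> K"
  unfolding tensor_kernel_def by (rule generate.incl)

lemma K_induct [consumes 1, case_names zero diff rel]:
  assumes "x \<in> K" "P 0" "\<And>x y. x \<in> K \<Longrightarrow> y \<in> K \<Longrightarrow> P x \<Longrightarrow> P y \<Longrightarrow> P (x - y)"
    "\<And>x. x \<in> tensor_relations p R S \<Longrightarrow> P x"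
  shows "P x"
proof -
  let ?H = "{x \<in> K. P x}"
  have minus: "- x \<in> ?H" if "x \<in> ?H" for x
    using assms(3)[OF K_zero] that K_diff[OF K_zero] assms(2) by force
  have "subgroup ?H (free_Abelian_group X)"
  proof
    show "?H \<subseteq> carrier (free_Abelian_group X)" using K_carrier by auto
    show "x \<otimes>\<^bsub>free_Abelian_group X\<^esub> y \<in> ?H" if "x \<in> ?H" "y \<in> ?H" for x y
      using assms(3)[of x "- y"] K_diff[of x "- y"] minus[OF that(2)] that by simp
    show "inv\<^bsub>free_Abelian_group X\<^esub> x \<in> ?H" if "x \<in> ?H" for x
      using minus[OF that] inv_free_Abelian_group[OF K_carrier, of x] that by simp
  qed (use K_zero assms(2) in simp)
  then have "generate (free_Abelian_group X) (tensor_relations p R S) \<subseteq> ?H"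
    using assms(4) K_relation by (intro group.generate_subgroup_incl[OF group_free_Abelian_group]) auto
  then have "K \<subseteq> ?H" by (simp add: tensor_kernel_def)
  then show ?thesis using assms(1) by blast
qed

text \<open>Multiplication by a basis element turns a relation into one of the same kind.
  Consequently the kernel, which is generated only as a group, is an ideal.\<close>

lemma tensor_relations_mult:
  assumes "a \<in> carrier R" "b \<in> carrier S" "x \<in> tensor_relations p R S"
  shows "frag_of (a, b) \<otimes>\<^bsub>F\<^esub> x \<in> tensor_relations p R S"
  using assms(3) unfolding tensor_relations_def
proof (elim UnE CollectE exE conjE, goal_cases)
  case (1 r r' s)
  then have eq: "frag_of (a, b) \<otimes>\<^bsub>F\<^esub> x = frag_of ((a \<otimes>\<^bsub>R\<^esub> r) \<oplus>\<^bsub>R\<^esub> (a \<otimes>\<^bsub>R\<^esub> r'), b \<otimes>\<^bsub>S\<^esub> s) -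
      frag_of (a \<otimes>\<^bsub>R\<^esub> r, b \<otimes>\<^bsub>S\<^esub> s) - frag_of (a \<otimes>\<^bsub>R\<^esub> r', b \<otimes>\<^bsub>S\<^esub> s)"
    using assms by (simp add: F_mult_diff R.r_distr)
  show ?case
    by (rule UnI1, rule UnI1, intro CollectI exI conjI, rule eq) (use assms 1 in auto)
next
  case (2 r s s')
  then have eq: "frag_of (a, b) \<otimes>\<^bsub>F\<^esub> x = frag_of (a \<otimes>\<^bsub>R\<^esub> r, (b \<otimes>\<^bsub>S\<^esub> s) \<oplus>\<^bsub>S\<^esub> (b \<otimes>\<^bsub>S\<^esub> s')) -
      frag_of (a \<otimes>\<^bsub>R\<^esub> r, b \<otimes>\<^bsub>S\<^esub> s) - frag_of (a \<otimes>\<^bsub>R\<^esub> r, b \<otimes>\<^bsub>S\<^esub> s')"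
    using assms by (simp add: F_mult_diff S.r_distr)
  show ?case
    by (rule UnI1, rule UnI2, intro CollectI exI conjI, rule eq) (use assms 2 in auto)
next
  case (3 k r s)
  then have eq: "frag_of (a, b) \<otimes>\<^bsub>F\<^esub> x =
      frag_of ([k] \<cdot>\<^bsub>R\<^esub> (a \<otimes>\<^bsub>R\<^esub> r), b \<otimes>\<^bsub>S\<^esub> s) - frag_of (a \<otimes>\<^bsub>R\<^esub> r, [k] \<cdot>\<^bsub>S\<^esub> (b \<otimes>\<^bsub>S\<^esub> s))"
    using assms by (simp add: F_mult_diff R.add_pow_rdistr_int S.add_pow_rdistr_int)
  show ?case
    by (rule UnI2, intro CollectI exI conjI, rule eq) (use assms 3 in auto)
qed

lemma K_ideal: "ideal K F"
proof (rule F.ideal_from_subgroup[OF K_subgroup])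
  fix x k assume "x \<in> carrier F" and k: "k \<in> K"
  then have "Poly_Mapping.keys x \<subseteq> X" by simp
  then show "x \<otimes>\<^bsub>F\<^esub> k \<in> K"
  proof (induction x rule: F_induct)
    case (frag_of a b)
    from k show ?case
      by (induction k rule: K_induct)
        (simp_all add: F_mult_diff K_zero K_diff K_relation tensor_relations_mult frag_of)
  qed (simp_all add: F_mult_diff K_zero K_diff)
qed

section \<open>The tensor ring and its universal property\<close>

lemma Q_cring: "cring Q"
  unfolding tensor_ring_def by (rule ideal.quotient_is_cring[OF K_ideal F_cring])

sublocale Q: cring Q by (rule Q_cring)

abbreviation (input) "proj \<equiv> a_r_coset F K"

lemma proj_hom: "proj \<in> ring_hom F Q"
  unfolding tensor_ring_def by (rule ideal.rcos_ring_hom[OF K_ideal])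

lemma proj_eq:
  assumes "Poly_Mapping.keys x \<subseteq> X" "Poly_Mapping.keys y \<subseteq> X"
  shows "proj x = proj y \<longleftrightarrow> x - y \<in> K"
  using F.quotient_eq_iff_same_a_r_cos[OF K_ideal, of x y] assms F_minus[of x y] by simp

lemma proj_add:
  assumes "Poly_Mapping.keys x \<subseteq> X" "Poly_Mapping.keys y \<subseteq> X"
  shows "proj (x + y) = proj x \<oplus>\<^bsub>Q\<^esub> proj y"
  using ring_hom_add[OF proj_hom, of x y] assms by simp

lemma pure_closed [simp]:
  "r \<in> carrier R \<Longrightarrow> s \<in> carrier S \<Longrightarrow> r \<diamondop> s \<in> carrier Q"
  unfolding pure_tensor_def using ring_hom_closed[OF proj_hom] by auto

lemma pure_add_left:
  assumes "r \<in> carrier R" "r' \<in> carrier R" "s \<in> carrier S"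
  shows "(r \<oplus>\<^bsub>R\<^esub> r') \<diamondop> s = (r \<diamondop> s) \<oplus>\<^bsub>Q\<^esub> (r' \<diamondop> s)"
proof -
  have "frag_of (r \<oplus>\<^bsub>R\<^esub> r', s) - frag_of (r, s) - frag_of (r', s) \<in> K"
    using assms by (intro K_relation) (auto simp: tensor_relations_def)
  then have "frag_of (r \<oplus>\<^bsub>R\<^esub> r', s) - (frag_of (r, s) + frag_of (r', s)) \<in> K"
    by (simp add: diff_diff_eq)
  moreover have "Poly_Mapping.keys (frag_of (r, s) + frag_of (r', s)) \<subseteq> X"
    using assms keys_add[of "frag_of (r, s)" "frag_of (r', s)"] by auto
  ultimately show ?thesis
    unfolding pure_tensor_def using assms by (simp add: proj_eq flip: proj_add)
qed

lemma pure_add_right: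
  assumes "r \<in> carrier R" "s \<in> carrier S" "s' \<in> carrier S"
  shows "r \<diamondop> (s \<oplus>\<^bsub>S\<^esub> s') = (r \<diamondop> s) \<oplus>\<^bsub>Q\<^esub> (r \<diamondop> s')"
proof -
  have "frag_of (r, s \<oplus>\<^bsub>S\<^esub> s') - frag_of (r, s) - frag_of (r, s') \<in> K"
    using assms by (intro K_relation) (auto simp: tensor_relations_def)
  then have "frag_of (r, s \<oplus>\<^bsub>S\<^esub> s') - (frag_of (r, s) + frag_of (r, s')) \<in> K"
    by (simp add: diff_diff_eq)
  moreover have "Poly_Mapping.keys (frag_of (r, s) + frag_of (r, s')) \<subseteq> X"
    using assms keys_add[of "frag_of (r, s)" "frag_of (r, s')"] by auto
  ultimately show ?thesis
    unfolding pure_tensor_def using assms by (simp add: proj_eq flip: proj_add)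
qed

lemma pure_mult:
  assumes "r \<in> carrier R" "s \<in> carrier S" "r' \<in> carrier R" "s' \<in> carrier S"
  shows "(r \<diamondop> s) \<otimes>\<^bsub>Q\<^esub> (r' \<diamondop> s') = (r \<otimes>\<^bsub>R\<^esub> r') \<diamondop> (s \<otimes>\<^bsub>S\<^esub> s')"
  unfolding pure_tensor_def
  using ring_hom_mult[OF proj_hom, of "frag_of (r, s)" "frag_of (r', s')"] assms by simp

lemma pure_one: "\<one>\<^bsub>R\<^esub> \<diamondop> \<one>\<^bsub>S\<^esub> = \<one>\<^bsub>Q\<^esub>"
  unfolding pure_tensor_def using ring_hom_one[OF proj_hom] by simp

lemma pure_additive:
  "s \<in> carrier S \<Longrightarrow> (\<lambda>r. r \<diamondop> s) \<in> hom (add_monoid R) (add_monoid Q)"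
  "r \<in> carrier R \<Longrightarrow> (\<lambda>s. r \<diamondop> s) \<in> hom (add_monoid S) (add_monoid Q)"
  by (rule additive_mapI; simp add: pure_add_left pure_add_right)+

lemmas pure_left = additive_mapD[OF R.ring_axioms Q.ring_axioms pure_additive(1)]

lemma char_Q: "[p] \<cdot>\<^bsub>Q\<^esub> \<one>\<^bsub>Q\<^esub> = \<zero>\<^bsub>Q\<^esub>"
proof -
  have "[int p] \<cdot>\<^bsub>R\<^esub> \<one>\<^bsub>R\<^esub> = \<zero>\<^bsub>R\<^esub>"
    using char_R by (simp add: add_pow_def int_pow_int)
  then have "[int p] \<cdot>\<^bsub>Q\<^esub> \<one>\<^bsub>Q\<^esub> = \<zero>\<^bsub>Q\<^esub>"
    using pure_left(5)[of "\<one>\<^bsub>S\<^esub>" "\<one>\<^bsub>R\<^esub>" "int p"] pure_left(3)[of "\<one>\<^bsub>S\<^esub>"] by (simp add: pure_one)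
  then show ?thesis by (simp add: add_pow_def int_pow_int)
qed

lemma tensor_subgroup_induct:
  assumes "subgroup H (add_monoid Q)" "\<And>r s. r \<in> carrier R \<Longrightarrow> s \<in> carrier S \<Longrightarrow> r \<diamondop> s \<in> H"
    and "x \<in> carrier Q"
  shows "x \<in> H"
proof -
  obtain y where y: "y \<in> carrier F" "x = proj y"
    using assms(3) unfolding tensor_ring_def FactRing_def A_RCOSETS_def RCOSETS_def a_r_coset_def
    by auto
  have "Poly_Mapping.keys y \<subseteq> X" using y by simp
  then have "proj y \<in> H"
  proof (induction y rule: F_induct)
    case zero
    have "proj 0 = \<zero>\<^bsub>Q\<^esub>" using proj_add[of 0 0] ring_hom_closed[OF proj_hom, of 0] by simp
    then show ?case using subgroup.one_closed[OF assms(1)] by simp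
  next
    case (diff x y)
    have c: "proj x \<in> carrier Q" "proj y \<in> carrier Q" "proj (x - y) \<in> carrier Q"
      using ring_hom_closed[OF proj_hom] diff keys_diff[of x y] by auto
    have "proj x = proj (x - y) \<oplus>\<^bsub>Q\<^esub> proj y"
      using proj_add[of "x - y" y] diff keys_diff[of x y] by auto
    then have "proj (x - y) = proj x \<oplus>\<^bsub>Q\<^esub> (\<ominus>\<^bsub>Q\<^esub> proj y)"
      using c by (simp add: Q.a_assoc Q.r_neg)
    then show ?case
      using diff subgroup.m_closed[OF assms(1)] subgroup.m_inv_closed[OF assms(1)]
      by (simp add: a_inv_def)
  next
    case (frag_of r s)
    then show ?case using assms(2) by (simp add: pure_tensor_def)
  qed
  then show ?thesis using y by simp
qed

text \<open>A biadditive map automatically respects the relation that moves a scalar of F_p across,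
  because additive maps commute with integer multiples. The map is built on the free group, vanishes
  on the relations and descends to the quotient group.\<close>

lemma tensor_lift:
  assumes "ring C" and cl: "\<And>r s. r \<in> carrier R \<Longrightarrow> s \<in> carrier S \<Longrightarrow> h r s \<in> carrier C"
    and l: "\<And>r r' s. r \<in> carrier R \<Longrightarrow> r' \<in> carrier R \<Longrightarrow> s \<in> carrier S \<Longrightarrow>
      h (r \<oplus>\<^bsub>R\<^esub> r') s = h r s \<oplus>\<^bsub>C\<^esub> h r' s"
    and r: "\<And>r s s'. r \<in> carrier R \<Longrightarrow> s \<in> carrier S \<Longrightarrow> s' \<in> carrier S \<Longrightarrow>
      h r (s \<oplus>\<^bsub>S\<^esub> s') = h r s \<oplus>\<^bsub>C\<^esub> h r s'"
  obtains f where "f \<in> hom (add_monoid Q) (add_monoid C)"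
    "\<And>r s. r \<in> carrier R \<Longrightarrow> s \<in> carrier S \<Longrightarrow> f (r \<diamondop> s) = h r s"
proof -
  interpret C: ring C by fact
  obtain g where g: "g \<in> hom (free_Abelian_group X) (add_monoid C)"
    "\<And>x. x \<in> X \<Longrightarrow> g (frag_of x) = case_prod h x"
  proof -
    have "case_prod h ` X \<subseteq> carrier (add_monoid C)" using cl by auto
    then show thesis by (rule comm_group.free_Abelian_group_universal[OF C.a_comm_group]) (rule that)
  qed
  note gF = additive_mapD[OF F.ring_axioms \<open>ring C\<close>, of g, unfolded add_monoid_F, OF g(1)]
  have g0: "g 0 = \<zero>\<^bsub>C\<^esub>" using gF(3) by (simp add: F_zero)
  have gc: "g x \<in> carrier C" if "Poly_Mapping.keys x \<subseteq> X" for x using gF(1) that by simp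
  have gd: "g (x - y) = g x \<ominus>\<^bsub>C\<^esub> g y" if "Poly_Mapping.keys x \<subseteq> X" "Poly_Mapping.keys y \<subseteq> X" for x y
    using gF(2)[of x "\<ominus>\<^bsub>F\<^esub> y"] gF(4)[of y] F_minus[OF that] that F.a_inv_closed[of y]
    by (simp add: a_minus_def del: F.a_inv_closed)
  have kd: "Poly_Mapping.keys (x - y) \<subseteq> X" if "Poly_Mapping.keys x \<subseteq> X" "Poly_Mapping.keys y \<subseteq> X" for x y
    using that keys_diff[of x y] by blast
  have rel: "g x = \<zero>\<^bsub>C\<^esub>" if "x \<in> tensor_relations p R S" for x
    using that unfolding tensor_relations_def
  proof (elim UnE CollectE exE conjE, goal_cases)
    case (1 r r' s)
    then show ?case using cl
      by (simp add: gd kd g(2) l a_minus_def C.minus_add) (simp add: C.a_ac C.r_neg C.r_neg2)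
  next
    case (2 r s s')
    then show ?case using cl
      by (simp add: gd kd g(2) assms(4) a_minus_def C.minus_add) (simp add: C.a_ac C.r_neg C.r_neg2)
  next
    case (3 k r s)
    have "h ([k] \<cdot>\<^bsub>R\<^esub> r) s = [k] \<cdot>\<^bsub>C\<^esub> h r s"
      using 3 cl l by (intro additive_mapD(5)[OF R.ring_axioms \<open>ring C\<close>] additive_mapI) auto
    moreover have "h r ([k] \<cdot>\<^bsub>S\<^esub> s) = [k] \<cdot>\<^bsub>C\<^esub> h r s"
      using 3 cl assms(4) by (intro additive_mapD(5)[OF S.ring_axioms \<open>ring C\<close>] additive_mapI) auto
    ultimately show ?case using 3 cl by (simp add: gd g(2) a_minus_def C.r_neg)
  qed
  have gK: "g x = \<zero>\<^bsub>C\<^esub>" if "x \<in> K" for x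
    using that by (induction x rule: K_induct) (simp_all add: g0 rel gd K_carrier a_minus_def)
  have N: "K \<lhd> free_Abelian_group X"
    using F.ideal_is_normal[OF K_ideal] unfolding add_monoid_F .
  have const: "g x = g y" if "x \<in> carrier (free_Abelian_group X)" "y \<in> carrier (free_Abelian_group X)"
      "K #>\<^bsub>free_Abelian_group X\<^esub> x = K #>\<^bsub>free_Abelian_group X\<^esub> y" for x y
  proof -
    have c: "Poly_Mapping.keys x \<subseteq> X" "Poly_Mapping.keys y \<subseteq> X" using that by simp_all
    have "x - y \<in> K" using that(3) proj_eq[OF c] unfolding a_r_coset_def add_monoid_F by simp
    then have "g x \<ominus>\<^bsub>C\<^esub> g y = \<zero>\<^bsub>C\<^esub>" using gK[of "x - y"] gd[OF c] by simp
    then show ?thesis using gc c by simp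
  qed
  obtain f where f: "f \<in> hom (free_Abelian_group X Mod K) (add_monoid C)"
    "\<And>x. x \<in> carrier (free_Abelian_group X) \<Longrightarrow> f (K #>\<^bsub>free_Abelian_group X\<^esub> x) = g x"
    using FactGroup_universal[OF g(1) N const] by blast
  have "add_monoid Q = free_Abelian_group X Mod K"
    unfolding tensor_ring_def FactRing_def FactGroup_def A_RCOSETS_def set_add_def add_monoid_F by simp
  then have "f \<in> hom (add_monoid Q) (add_monoid C)" using f(1) by (simp only:)
  moreover have "f (r \<diamondop> s) = h r s" if "r \<in> carrier R" "s \<in> carrier S" for r s
    using f(2)[of "frag_of (r, s)"] g(2)[of "(r, s)"] that
    unfolding pure_tensor_def a_r_coset_def add_monoid_F by simp
  ultimately show thesis using that by blast
qed

end

section \<open>Sums of tensors of minimal length\<close>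

locale biadditive =
  fixes p :: nat and A :: "('a, 'm) ring_scheme" and B :: "('b, 'n) ring_scheme"
    and Q :: "('q, 'k) ring_scheme" and t :: "'a \<Rightarrow> 'b \<Rightarrow> 'q"
  assumes A: "cring A" and B: "cring B" and Q: "ring Q" and prime: "prime p"
    and char_B: "[p] \<cdot>\<^bsub>B\<^esub> \<one>\<^bsub>B\<^esub> = \<zero>\<^bsub>B\<^esub>"
    and left: "\<And>b. b \<in> carrier B \<Longrightarrow> (\<lambda>a. t a b) \<in> hom (add_monoid A) (add_monoid Q)"
    and right: "\<And>a. a \<in> carrier A \<Longrightarrow> (\<lambda>b. t a b) \<in> hom (add_monoid B) (add_monoid Q)"
begin

sublocale A: cring A by (rule A)
sublocale B: cring B by (rule B)
sublocale Q: ring Q by (rule Q)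

lemmas t_left = additive_mapD[OF A.ring_axioms Q left]
lemmas t_right = additive_mapD[OF B.ring_axioms Q right]

text \<open>Lists keep the number of terms available, which is the quantity to be minimised.\<close>

definition sum_pairs :: "('a \<times> 'b) list \<Rightarrow> 'q" where
  "sum_pairs xs = foldr (\<lambda>(a, b) q. t a b \<oplus>\<^bsub>Q\<^esub> q) xs \<zero>\<^bsub>Q\<^esub>"

lemma sum_pairs_simps [simp]:
  "sum_pairs [] = \<zero>\<^bsub>Q\<^esub>" "sum_pairs ((a, b) # xs) = t a b \<oplus>\<^bsub>Q\<^esub> sum_pairs xs"
  by (simp_all add: sum_pairs_def)

lemma sum_pairs_closed [simp]:
  "set xs \<subseteq> carrier A \<times> carrier B \<Longrightarrow> sum_pairs xs \<in> carrier Q"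
  by (induction xs) (auto simp: t_left)

lemma sum_pairs_append:
  assumes "set xs \<subseteq> carrier A \<times> carrier B" "set ys \<subseteq> carrier A \<times> carrier B"
  shows "sum_pairs (xs @ ys) = sum_pairs xs \<oplus>\<^bsub>Q\<^esub> sum_pairs ys"
  using assms by (induction xs) (auto simp: t_left Q.a_assoc)

lemma sum_pairs_middle:
  assumes "set us \<subseteq> carrier A \<times> carrier B" "set vs \<subseteq> carrier A \<times> carrier B"
    "a \<in> carrier A" "b \<in> carrier B"
  shows "sum_pairs (us @ (a, b) # vs) = t a b \<oplus>\<^bsub>Q\<^esub> sum_pairs (us @ vs)"
  using assms by (simp add: sum_pairs_append t_left Q.a_lcomm)

text \<open>In a sum of tensors of minimal length, no second factor lies in the span of the others:
  otherwise its term could be absorbed into the remaining ones.\<close>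

lemma minimal_sum_independent:
  assumes xs: "set xs \<subseteq> carrier A \<times> carrier B" "xs = us @ (a, b) # vs"
    and min: "\<And>ys. set ys \<subseteq> carrier A \<times> carrier B \<Longrightarrow> sum_pairs ys = sum_pairs xs \<Longrightarrow> length xs \<le> length ys"
  obtains l where "fp_functional p B l" "[l b = 1] (mod int p)"
    "\<And>c d. (c, d) \<in> set (us @ vs) \<Longrightarrow> [l d = 0] (mod int p)"
proof -
  let ?X = "carrier A \<times> carrier B"
  define ys where "ys = us @ vs"
  define Z where "Z = {zs. set zs \<subseteq> ?X \<and> map snd zs = map snd ys}"
  \<comment> \<open>\<open>H\<close> plays the role of the span of the second factors of
    \<open>ys\<close>, described by absorption: adding a term with second factor in \<open>H\<close>
    to a sum from \<open>Z\<close> changes only the first factors. Quantifying over all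
    \<open>zs\<close> gives closure under addition by absorbing twice; quantifying over all
    \<open>c\<close> gives closure under negation by moving the sign to \<open>c\<close>.\<close>
  define H where "H = {d \<in> carrier B. \<forall>zs\<in>Z. \<forall>c\<in>carrier A. \<exists>zs'\<in>Z. sum_pairs zs \<oplus>\<^bsub>Q\<^esub> t c d = sum_pairs zs'}"
  have ZX: "set zs \<subseteq> ?X" if "zs \<in> Z" for zs using that by (simp add: Z_def)
  have H: "subgroup H (add_monoid B)"
  proof (rule B.additive_subgroupI)
    show "H \<subseteq> carrier B" by (auto simp: H_def)
    show "\<zero>\<^bsub>B\<^esub> \<in> H"
      using sum_pairs_closed[OF ZX] by (auto simp: H_def t_right)
    show "\<ominus>\<^bsub>B\<^esub> d \<in> H" if "d \<in> H" for d
    proof -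
      have d: "d \<in> carrier B" using that by (simp add: H_def)
      have "\<exists>zs'\<in>Z. sum_pairs zs \<oplus>\<^bsub>Q\<^esub> t c (\<ominus>\<^bsub>B\<^esub> d) = sum_pairs zs'"
        if "zs \<in> Z" "c \<in> carrier A" for zs c
      proof -
        have "t c (\<ominus>\<^bsub>B\<^esub> d) = t (\<ominus>\<^bsub>A\<^esub> c) d" using that d by (simp add: t_left t_right)
        then show ?thesis using \<open>d \<in> H\<close> that unfolding H_def by simp
      qed
      then show ?thesis using d by (simp add: H_def)
    qed
    show "d \<oplus>\<^bsub>B\<^esub> d' \<in> H" if "d \<in> H" "d' \<in> H" for d d'
    proof -
      have d: "d \<in> carrier B" "d' \<in> carrier B" using that by (simp_all add: H_def)
      have "\<exists>zs'\<in>Z. sum_pairs zs \<oplus>\<^bsub>Q\<^esub> t c (d \<oplus>\<^bsub>B\<^esub> d') = sum_pairs zs'"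
        if "zs \<in> Z" "c \<in> carrier A" for zs c
      proof -
        obtain zs' where zs': "zs' \<in> Z" "sum_pairs zs \<oplus>\<^bsub>Q\<^esub> t c d = sum_pairs zs'"
          using \<open>d \<in> H\<close> \<open>zs \<in> Z\<close> \<open>c \<in> carrier A\<close> unfolding H_def by blast
        obtain zs'' where zs'': "zs'' \<in> Z" "sum_pairs zs' \<oplus>\<^bsub>Q\<^esub> t c d' = sum_pairs zs''"
          using \<open>d' \<in> H\<close> \<open>zs' \<in> Z\<close> \<open>c \<in> carrier A\<close> unfolding H_def by blast
        have "sum_pairs zs \<oplus>\<^bsub>Q\<^esub> t c (d \<oplus>\<^bsub>B\<^esub> d') = (sum_pairs zs \<oplus>\<^bsub>Q\<^esub> t c d) \<oplus>\<^bsub>Q\<^esub> t c d'"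
          using that d ZX[OF that(1)] by (simp add: t_right Q.a_assoc)
        then show ?thesis using zs' zs'' by auto
      qed
      then show ?thesis using d by (simp add: H_def)
    qed
  qed
  have mem: "d \<in> H" if "(c, d) \<in> set ys" for c d
  proof -
    have "set ys \<subseteq> ?X" using xs by (auto simp: ys_def)
    then have d: "d \<in> carrier B" using that by blast
    have "\<exists>zs'\<in>Z. sum_pairs zs \<oplus>\<^bsub>Q\<^esub> t e d = sum_pairs zs'" if zs: "zs \<in> Z" and e: "e \<in> carrier A" for zs e
    proof -
      have "d \<in> set (map snd ys)" using \<open>(c, d) \<in> set ys\<close> by force
      then have "d \<in> set (map snd zs)" using zs by (simp only: Z_def mem_Collect_eq)
      then obtain c' where "(c', d) \<in> set zs" by auto
      then obtain zs1 zs2 where z: "zs = zs1 @ (c', d) # zs2" by (meson split_list)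
      have c': "c' \<in> carrier A" and s: "set zs1 \<subseteq> ?X" "set zs2 \<subseteq> ?X" using ZX[OF zs] z by auto
      let ?zs = "zs1 @ (c' \<oplus>\<^bsub>A\<^esub> e, d) # zs2"
      have "sum_pairs zs \<oplus>\<^bsub>Q\<^esub> t e d = t c' d \<oplus>\<^bsub>Q\<^esub> sum_pairs (zs1 @ zs2) \<oplus>\<^bsub>Q\<^esub> t e d"
        unfolding z using s c' d by (simp add: sum_pairs_middle)
      also have "\<dots> = t (c' \<oplus>\<^bsub>A\<^esub> e) d \<oplus>\<^bsub>Q\<^esub> sum_pairs (zs1 @ zs2)"
        using s c' d e by (simp add: t_left Q.a_ac)
      also have "\<dots> = sum_pairs ?zs" using s c' d e by (simp add: sum_pairs_middle)
      finally have "sum_pairs zs \<oplus>\<^bsub>Q\<^esub> t e d = sum_pairs ?zs" .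
      moreover have "?zs \<in> Z" using zs s c' d e by (simp add: Z_def z)
      ultimately show ?thesis by blast
    qed
    then show ?thesis using d by (simp add: H_def)
  qed
  \<comment> \<open>Otherwise the term of \<open>(a, b)\<close> would disappear into the others and
    leave a representation shorter by one.\<close>
  have "b \<notin> H"
  proof
    assume bH: "b \<in> H"
    have s: "set us \<subseteq> ?X" "set vs \<subseteq> ?X" "a \<in> carrier A" "b \<in> carrier B" using xs by auto
    have "ys \<in> Z" using s by (simp add: ys_def Z_def)
    then obtain zs where zs: "zs \<in> Z" "sum_pairs ys \<oplus>\<^bsub>Q\<^esub> t a b = sum_pairs zs"
      using bH s(3) unfolding H_def by blast
    have "sum_pairs zs = sum_pairs xs"
      using zs(2) s xs(2) by (simp add: ys_def sum_pairs_middle t_left Q.a_comm)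
    then have "length xs \<le> length zs" using min ZX[OF zs(1)] by blast
    moreover have "length zs = length ys" using zs(1) unfolding Z_def by (metis (lifting) length_map mem_Collect_eq)
    ultimately show False by (simp add: xs(2) ys_def)
  qed
  moreover have "b \<in> carrier B" using xs by auto
  ultimately obtain l where "fp_functional p B l" "\<And>w. w \<in> H \<Longrightarrow> [l w = 0] (mod int p)" "[l b = 1] (mod int p)"
    using B.functional_exists[OF prime char_B H] by blast
  then show thesis using that mem ys_def by blast
qed

end

section \<open>Spans of pure tensors and contractions\<close>

context tensor
begin

sublocale biadditive p R S Q "(\<diamondop>)"
  by unfold_locales (use R S p char_S pure_additive in \<open>auto intro: cring.axioms\<close>)

lemma tensor_hom_eqI:
  assumes "ring C" "f \<in> hom (add_monoid Q) (add_monoid C)" "g \<in> hom (add_monoid Q) (add_monoid C)"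
    and "\<And>r s. r \<in> carrier R \<Longrightarrow> s \<in> carrier S \<Longrightarrow> f (r \<diamondop> s) = g (r \<diamondop> s)" and "x \<in> carrier Q"
  shows "f x = g x"
  using tensor_subgroup_induct[OF additive_equalizer_subgroup[OF Q.ring_axioms assms(1,2,3)] _ assms(5)]
    assms(4) by auto

lemma Q_mult_additive: "x \<in> carrier Q \<Longrightarrow> (\<lambda>y. x \<otimes>\<^bsub>Q\<^esub> y) \<in> hom (add_monoid Q) (add_monoid Q)"
  by (rule additive_mapI) (simp_all add: Q.r_distr)

text \<open>A union of products \<open>A i \<times> B i\<close> then represents a sum of tensor
  products inside \<open>Q\<close>. Additive generation reaches the whole F_p-span, because scalars
  act as integer multiples.\<close>

definition tensor_span :: "('a \<times> 'b) set \<Rightarrow> ('a \<times> 'b \<Rightarrow>\<^sub>0 int) set set" where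
  "tensor_span T = generate (add_monoid Q) {r \<diamondop> s | r s. (r, s) \<in> T}"

lemma tensor_span_subgroup: "T \<subseteq> X \<Longrightarrow> subgroup (tensor_span T) (add_monoid Q)"
  unfolding tensor_span_def by (rule Q.add.generate_is_subgroup) auto

lemma tensor_span_incl: "(r, s) \<in> T \<Longrightarrow> r \<diamondop> s \<in> tensor_span T"
  unfolding tensor_span_def by (rule generate.incl) auto

lemma tensor_span_minimal:
  assumes "subgroup H (add_monoid Q)" "\<And>r s. (r, s) \<in> T \<Longrightarrow> r \<diamondop> s \<in> H"
  shows "tensor_span T \<subseteq> H"
  unfolding tensor_span_def using assms by (intro Q.add.generate_subgroup_incl) auto

lemma tensor_span_mono: "T \<subseteq> T' \<Longrightarrow> T' \<subseteq> X \<Longrightarrow> tensor_span T \<subseteq> tensor_span T'"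
  by (intro tensor_span_minimal tensor_span_subgroup tensor_span_incl) auto

text \<open>Bilinearity in two passes: with a pure tensor fixed on the left, the right factor runs
  over its span; then the right factor is fixed and the left one varies.\<close>

lemma tensor_span_mult:
  assumes "T \<subseteq> X" "T' \<subseteq> X" "subgroup L (add_monoid Q)"
    and prod: "\<And>r s r' s'. (r, s) \<in> T \<Longrightarrow> (r', s') \<in> T' \<Longrightarrow> (r \<otimes>\<^bsub>R\<^esub> r') \<diamondop> (s \<otimes>\<^bsub>S\<^esub> s') \<in> L"
    and "x \<in> tensor_span T" "y \<in> tensor_span T'"
  shows "x \<otimes>\<^bsub>Q\<^esub> y \<in> L"
proof -
  have 1: "tensor_span T' \<subseteq> {y \<in> carrier Q. (r \<diamondop> s) \<otimes>\<^bsub>Q\<^esub> y \<in> L}" if "(r, s) \<in> T" for r s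
  proof (rule tensor_span_minimal)
    have rs: "r \<in> carrier R" "s \<in> carrier S" using that assms(1) by auto
    show "subgroup {y \<in> carrier Q. (r \<diamondop> s) \<otimes>\<^bsub>Q\<^esub> y \<in> L} (add_monoid Q)"
      using rs by (intro additive_vimage_subgroup[OF Q.ring_axioms Q.ring_axioms _ assms(3)] Q_mult_additive) simp
    show "r' \<diamondop> s' \<in> {y \<in> carrier Q. (r \<diamondop> s) \<otimes>\<^bsub>Q\<^esub> y \<in> L}" if "(r', s') \<in> T'" for r' s'
      using prod[OF \<open>(r, s) \<in> T\<close> that] rs that assms(2) by (auto simp: pure_mult)
  qed
  have y: "y \<in> carrier Q"
    using subgroup.subset[OF tensor_span_subgroup[OF assms(2)]] assms(6) by auto
  have "tensor_span T \<subseteq> {x \<in> carrier Q. y \<otimes>\<^bsub>Q\<^esub> x \<in> L}"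
  proof (rule tensor_span_minimal)
    show "subgroup {x \<in> carrier Q. y \<otimes>\<^bsub>Q\<^esub> x \<in> L} (add_monoid Q)"
      using y by (intro additive_vimage_subgroup[OF Q.ring_axioms Q.ring_axioms _ assms(3)] Q_mult_additive)
    show "r \<diamondop> s \<in> {x \<in> carrier Q. y \<otimes>\<^bsub>Q\<^esub> x \<in> L}" if "(r, s) \<in> T" for r s
    proof -
      have "r \<diamondop> s \<in> carrier Q" using that assms(1) by auto
      then show ?thesis using 1[OF that] assms(6) y by (auto simp: Q.m_comm)
    qed
  qed
  then show ?thesis using assms(5) y by (auto simp: Q.m_comm)
qed

lemma tensor_span_carrier: "tensor_span X = carrier Q"
  using subgroup.subset[OF tensor_span_subgroup[OF order_refl]]
    tensor_subgroup_induct[OF tensor_span_subgroup[OF order_refl]] tensor_span_incl[of _ _ X]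
  by auto

lemma tensor_span_ideal:
  assumes "T \<subseteq> X" "\<And>r s a b. (r, s) \<in> T \<Longrightarrow> a \<in> carrier R \<Longrightarrow> b \<in> carrier S \<Longrightarrow> (a \<otimes>\<^bsub>R\<^esub> r, b \<otimes>\<^bsub>S\<^esub> s) \<in> T"
  shows "ideal (tensor_span T) Q"
proof (rule Q.ideal_from_subgroup[OF tensor_span_subgroup[OF assms(1)]])
  fix x y assume x: "x \<in> carrier Q" and y: "y \<in> tensor_span T"
  show "x \<otimes>\<^bsub>Q\<^esub> y \<in> tensor_span T"
    by (rule tensor_span_mult[OF order_refl assms(1) tensor_span_subgroup[OF assms(1)] _ _ y, of x])
      (use x assms(2) in \<open>auto simp: tensor_span_carrier intro: tensor_span_incl\<close>)
qed

text \<open>This is the identity of \<open>R\<close> tensored with \<open>l\<close>, followed by the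
  identification of R \<otimes> F_p with \<open>R\<close>.\<close>

lemma contraction_left:
  assumes "fp_functional p S l"
  obtains f where "f \<in> hom (add_monoid Q) (add_monoid R)"
    "\<And>r s. r \<in> carrier R \<Longrightarrow> s \<in> carrier S \<Longrightarrow> f (r \<diamondop> s) = [(l s)] \<cdot>\<^bsub>R\<^esub> r"
proof (rule tensor_lift[OF R.ring_axioms, of "\<lambda>r s. [(l s)] \<cdot>\<^bsub>R\<^esub> r"])
  show "[(l (s \<oplus>\<^bsub>S\<^esub> s'))] \<cdot>\<^bsub>R\<^esub> r = [(l s)] \<cdot>\<^bsub>R\<^esub> r \<oplus>\<^bsub>R\<^esub> [(l s')] \<cdot>\<^bsub>R\<^esub> r"
    if "r \<in> carrier R" "s \<in> carrier S" "s' \<in> carrier S" for r s s'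
    using R.char_int_pow_cong[OF char_R, of "l (s \<oplus>\<^bsub>S\<^esub> s')" "l s + l s'" r] that assms
    by (simp add: fp_functional_def R.add.int_pow_mult)
qed (simp_all add: R.add.int_pow_distrib that)

lemma contraction_right:
  assumes "fp_functional p R l"
  obtains f where "f \<in> hom (add_monoid Q) (add_monoid S)"
    "\<And>r s. r \<in> carrier R \<Longrightarrow> s \<in> carrier S \<Longrightarrow> f (r \<diamondop> s) = [(l r)] \<cdot>\<^bsub>S\<^esub> s"
proof (rule tensor_lift[OF S.ring_axioms, of "\<lambda>r s. [(l r)] \<cdot>\<^bsub>S\<^esub> s"])
  show "[(l (r \<oplus>\<^bsub>R\<^esub> r'))] \<cdot>\<^bsub>S\<^esub> s = [(l r)] \<cdot>\<^bsub>S\<^esub> s \<oplus>\<^bsub>S\<^esub> [(l r')] \<cdot>\<^bsub>S\<^esub> s"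
    if "r \<in> carrier R" "r' \<in> carrier R" "s \<in> carrier S" for r r' s
    using S.char_int_pow_cong[OF char_S, of "l (r \<oplus>\<^bsub>R\<^esub> r')" "l r + l r'" s] that assms
    by (simp add: fp_functional_def S.add.int_pow_mult)
qed (simp_all add: S.add.int_pow_distrib that)

text \<open>Contracting with a functional that vanishes on \<open>B\<close> and is 1 at
  \<open>y\<close> sends the whole span into \<open>A\<close>, but \<open>x \<diamondop> y\<close>
  to \<open>x\<close>. Every proof that the filtration in \<open>Q\<close> does jump rests on this
  separation.\<close>

lemma pure_notin_span:
  assumes "T \<subseteq> X" "subgroup A (add_monoid R)" "subgroup B (add_monoid S)"
    and x: "x \<in> carrier R" "x \<notin> A" and y: "y \<in> carrier S" "y \<notin> B"
    and T: "\<And>r s. (r, s) \<in> T \<Longrightarrow> r \<in> A \<or> s \<in> B"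
  shows "x \<diamondop> y \<notin> tensor_span T"
proof
  assume xy: "x \<diamondop> y \<in> tensor_span T"
  obtain l where l: "fp_functional p S l" "\<And>w. w \<in> B \<Longrightarrow> [l w = 0] (mod int p)" "[l y = 1] (mod int p)"
    using S.functional_exists[OF p char_S assms(3) y] by blast
  obtain f where f: "f \<in> hom (add_monoid Q) (add_monoid R)"
    "\<And>r s. r \<in> carrier R \<Longrightarrow> s \<in> carrier S \<Longrightarrow> f (r \<diamondop> s) = [(l s)] \<cdot>\<^bsub>R\<^esub> r"
    using contraction_left[OF l(1)] by blast
  have "tensor_span T \<subseteq> {w \<in> carrier Q. f w \<in> A}"
  proof (rule tensor_span_minimal)
    show "subgroup {w \<in> carrier Q. f w \<in> A} (add_monoid Q)"
      by (rule additive_vimage_subgroup[OF Q.ring_axioms R.ring_axioms f(1) assms(2)])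
    fix r s assume rs: "(r, s) \<in> T"
    then have c: "r \<in> carrier R" "s \<in> carrier S" using assms(1) by auto
    have "[(l s)] \<cdot>\<^bsub>R\<^esub> r \<in> A"
    proof (cases "r \<in> A")
      case True
      then show ?thesis
        using R.add.subgroup_int_pow_closed[OF assms(2), of r "l s"] by (simp add: add_pow_def)
    next
      case False
      then have "[(l s)] \<cdot>\<^bsub>R\<^esub> r = [(0::int)] \<cdot>\<^bsub>R\<^esub> r"
        using T[OF rs] l(2) c by (intro R.char_int_pow_cong[OF char_R]) auto
      then show ?thesis using subgroup.one_closed[OF assms(2)] by simp
    qed
    then show "r \<diamondop> s \<in> {w \<in> carrier Q. f w \<in> A}" using c f(2) by simp
  qed
  then have "f (x \<diamondop> y) \<in> A" using xy by blast
  moreover have "f (x \<diamondop> y) = x"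
    using R.char_int_pow_cong[OF char_R l(3) x(1)] f(2) x y by simp
  ultimately show False using x by simp
qed

lemma sum_pairs_surj:
  assumes "w \<in> carrier Q"
  obtains xs where "set xs \<subseteq> X" "sum_pairs xs = w"
proof -
  have "subgroup {sum_pairs xs | xs. set xs \<subseteq> X} (add_monoid Q)"
  proof (rule Q.additive_subgroupI)
    show "\<zero>\<^bsub>Q\<^esub> \<in> {sum_pairs xs | xs. set xs \<subseteq> X}" by (force intro: exI[of _ "[]"])
    show "x \<oplus>\<^bsub>Q\<^esub> y \<in> {sum_pairs xs | xs. set xs \<subseteq> X}"
      if xy: "x \<in> {sum_pairs xs | xs. set xs \<subseteq> X}" "y \<in> {sum_pairs xs | xs. set xs \<subseteq> X}" for x y
    proof -
      obtain xs ys where "set xs \<subseteq> X" "set ys \<subseteq> X" "x = sum_pairs xs" "y = sum_pairs ys" using xy by blast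
      then show ?thesis by (intro CollectI exI[of _ "xs @ ys"]) (simp add: sum_pairs_append)
    qed
    have neg: "sum_pairs (map (\<lambda>(r, s). (\<ominus>\<^bsub>R\<^esub> r, s)) xs) = \<ominus>\<^bsub>Q\<^esub> sum_pairs xs" if "set xs \<subseteq> X" for xs
      using that by (induction xs) (auto simp: pure_left Q.minus_add)
    show "\<ominus>\<^bsub>Q\<^esub> x \<in> {sum_pairs xs | xs. set xs \<subseteq> X}" if x: "x \<in> {sum_pairs xs | xs. set xs \<subseteq> X}" for x
    proof -
      obtain xs where xs: "set xs \<subseteq> X" "x = sum_pairs xs" using x by blast
      show ?thesis
        by (intro CollectI exI[of _ "map (\<lambda>(r, s). (\<ominus>\<^bsub>R\<^esub> r, s)) xs"]) (use xs neg in auto)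
    qed
  qed (use sum_pairs_closed in blast)
  moreover have "r \<diamondop> s \<in> {sum_pairs xs | xs. set xs \<subseteq> X}" if "r \<in> carrier R" "s \<in> carrier S" for r s
    using that by (intro CollectI exI[of _ "[(r, s)]"]) simp
  ultimately have "w \<in> {sum_pairs xs | xs. set xs \<subseteq> X}"
    using tensor_subgroup_induct assms by blast
  then show thesis using that by blast
qed

text \<open>All terms of a representation of \<open>w\<close> of minimal length have both factors in the required
  subgroups, because contractions with dual functionals recover these factors from \<open>w\<close>.\<close>

lemma mem_tensor_span_prod:
  assumes w: "w \<in> carrier Q" and A: "subgroup A (add_monoid R)" and B: "subgroup B (add_monoid S)"
    and left: "\<And>l f. fp_functional p S l \<Longrightarrow> f \<in> hom (add_monoid Q) (add_monoid R) \<Longrightarrow>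
      (\<And>r s. r \<in> carrier R \<Longrightarrow> s \<in> carrier S \<Longrightarrow> f (r \<diamondop> s) = [(l s)] \<cdot>\<^bsub>R\<^esub> r) \<Longrightarrow> f w \<in> A"
    and right: "\<And>l f. fp_functional p R l \<Longrightarrow> f \<in> hom (add_monoid Q) (add_monoid S) \<Longrightarrow>
      (\<And>r s. r \<in> carrier R \<Longrightarrow> s \<in> carrier S \<Longrightarrow> f (r \<diamondop> s) = [(l r)] \<cdot>\<^bsub>S\<^esub> s) \<Longrightarrow> f w \<in> B"
  shows "w \<in> tensor_span (A \<times> B)"
proof -
  \<comment> \<open>The independence argument concerns second factors. Exchanging \<open>R\<close>
    and \<open>S\<close> gives it for first factors, which is why it was set up for an arbitrary
    biadditive map.\<close>
  interpret swap: biadditive p S R Q "\<lambda>s r. r \<diamondop> s"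
    by unfold_locales (use p char_R pure_additive in auto)
  have swap_sum: "swap.sum_pairs (map prod.swap xs) = sum_pairs xs" for xs
    by (induction xs) auto
  define has_length where "has_length n \<longleftrightarrow> (\<exists>xs. set xs \<subseteq> X \<and> sum_pairs xs = w \<and> length xs = n)" for n
  have "\<exists>n. has_length n" using sum_pairs_surj[OF w] unfolding has_length_def by metis
  then have L: "has_length (LEAST n. has_length n)" by (rule LeastI_ex)
  then obtain xs where xs: "set xs \<subseteq> X" "sum_pairs xs = w" "length xs = (LEAST n. has_length n)"
    unfolding has_length_def by blast
  have min: "length xs \<le> length ys" if "set ys \<subseteq> X" "sum_pairs ys = w" for ys
    unfolding xs(3) by (rule Least_le) (use that in \<open>auto simp: has_length_def\<close>)
  have "r \<in> A \<and> s \<in> B" if rs: "(r, s) \<in> set xs" for r s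
  proof -
    obtain us vs where split: "xs = us @ (r, s) # vs" using split_list[OF rs] by blast
    have c: "r \<in> carrier R" "s \<in> carrier S" "set us \<subseteq> X" "set vs \<subseteq> X" "set (us @ vs) \<subseteq> X"
      using xs(1) split by auto
    have w_split: "w = (r \<diamondop> s) \<oplus>\<^bsub>Q\<^esub> sum_pairs (us @ vs)"
      using c xs(2) split by (simp add: sum_pairs_middle)
    obtain l where l: "fp_functional p S l" "[l s = 1] (mod int p)"
      "\<And>c d. (c, d) \<in> set (us @ vs) \<Longrightarrow> [l d = 0] (mod int p)"
      using minimal_sum_independent[OF xs(1) split] min xs(2) by blast
    obtain f where f: "f \<in> hom (add_monoid Q) (add_monoid R)"
      "\<And>r s. r \<in> carrier R \<Longrightarrow> s \<in> carrier S \<Longrightarrow> f (r \<diamondop> s) = [(l s)] \<cdot>\<^bsub>R\<^esub> r"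
      using contraction_left[OF l(1)] by blast
    note fh = additive_mapD[OF Q.ring_axioms R.ring_axioms f(1)]
    have "f (sum_pairs ys) = \<zero>\<^bsub>R\<^esub>" if "set ys \<subseteq> X" "\<And>c d. (c, d) \<in> set ys \<Longrightarrow> [l d = 0] (mod int p)" for ys
      using that
    proof (induction ys)
      case (Cons x ys)
      obtain c d where x: "x = (c, d)" by force
      have "[(l d)] \<cdot>\<^bsub>R\<^esub> c = [(0::int)] \<cdot>\<^bsub>R\<^esub> c"
        using Cons.prems x by (intro R.char_int_pow_cong[OF char_R]) auto
      moreover have "f (sum_pairs ys) = \<zero>\<^bsub>R\<^esub>" by (rule Cons.IH) (use Cons.prems in auto)
      ultimately show ?case using Cons.prems(1) x by (simp add: fh f(2))
    qed (simp add: fh)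
    then have "f (sum_pairs (us @ vs)) = \<zero>\<^bsub>R\<^esub>" using c(5) l(3) by blast
    \<comment> \<open>The contraction by \<open>l\<close> kills all other terms and returns the
      first factor of the chosen one.\<close>
    then have "f w = r"
      using c R.char_int_pow_cong[OF char_R l(2) c(1)] unfolding w_split by (simp add: fh f(2))
    then have "r \<in> A" using left[OF l(1) f] by simp
    have sw: "set (map prod.swap xs) \<subseteq> carrier S \<times> carrier R" using xs(1) by auto
    have sw_split: "map prod.swap xs = map prod.swap us @ (s, r) # map prod.swap vs" by (simp add: split)
    \<comment> \<open>Exchanging the factors preserves both value and length, so the exchanged list
      is again minimal.\<close>
    have sw_min: "length (map prod.swap xs) \<le> length ys"
      if ys: "set ys \<subseteq> carrier S \<times> carrier R" "swap.sum_pairs ys = swap.sum_pairs (map prod.swap xs)" for ys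
    proof -
      have "sum_pairs (map prod.swap ys) = w"
        using ys(2) swap_sum[of "map prod.swap ys"] swap_sum[of xs] xs(2) by simp
      moreover have "set (map prod.swap ys) \<subseteq> X" using ys(1) by auto
      ultimately show ?thesis using min[of "map prod.swap ys"] by simp
    qed
    obtain l' where l': "fp_functional p R l'" "[l' r = 1] (mod int p)"
      "\<And>d c. (d, c) \<in> set (map prod.swap us @ map prod.swap vs) \<Longrightarrow> [l' c = 0] (mod int p)"
      using swap.minimal_sum_independent[OF sw sw_split sw_min] by blast
    obtain g where g: "g \<in> hom (add_monoid Q) (add_monoid S)"
      "\<And>r s. r \<in> carrier R \<Longrightarrow> s \<in> carrier S \<Longrightarrow> g (r \<diamondop> s) = [(l' r)] \<cdot>\<^bsub>S\<^esub> s"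
      using contraction_right[OF l'(1)] by blast
    note gh = additive_mapD[OF Q.ring_axioms S.ring_axioms g(1)]
    have "g (sum_pairs ys) = \<zero>\<^bsub>S\<^esub>" if "set ys \<subseteq> X" "\<And>c d. (c, d) \<in> set ys \<Longrightarrow> [l' c = 0] (mod int p)" for ys
      using that
    proof (induction ys)
      case (Cons x ys)
      obtain c d where x: "x = (c, d)" by force
      have "[(l' c)] \<cdot>\<^bsub>S\<^esub> d = [(0::int)] \<cdot>\<^bsub>S\<^esub> d"
        using Cons.prems x by (intro S.char_int_pow_cong[OF char_S]) auto
      moreover have "g (sum_pairs ys) = \<zero>\<^bsub>S\<^esub>" by (rule Cons.IH) (use Cons.prems in auto)
      ultimately show ?case using Cons.prems(1) x by (simp add: gh g(2))
    qed (simp add: gh)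
    moreover have "[l' c = 0] (mod int p)" if "(c, d) \<in> set (us @ vs)" for c d
      using l'(3)[of d c] that by (force simp: image_iff)
    ultimately have "g (sum_pairs (us @ vs)) = \<zero>\<^bsub>S\<^esub>" using c(5) by blast
    then have "g w = s"
      using c S.char_int_pow_cong[OF char_S l'(2) c(2)] unfolding w_split by (simp add: gh g(2))
    then have "s \<in> B" using right[OF l'(1) g] by simp
    then show ?thesis using \<open>r \<in> A\<close> by blast
  qed
  moreover have "sum_pairs ys \<in> tensor_span (A \<times> B)" if "set ys \<subseteq> A \<times> B" for ys
  proof -
    have "A \<times> B \<subseteq> X" using subgroup.subset[OF A] subgroup.subset[OF B] by auto
    note H = tensor_span_subgroup[OF this]
    show ?thesis using that
      by (induction ys)
        (use subgroup.one_closed[OF H] subgroup.m_closed[OF H] tensor_span_incl in auto)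
  qed
  moreover have "set xs \<subseteq> A \<times> B" using calculation(1) by auto
  ultimately show ?thesis using xs(2) by blast
qed

end

section \<open>Differential operators on the tensor product\<close>

context tensor
begin

lemma pure_pow:
  assumes "r \<in> carrier R" "s \<in> carrier S"
  shows "(r \<diamondop> s) [^]\<^bsub>Q\<^esub> (n::nat) = (r [^]\<^bsub>R\<^esub> n) \<diamondop> (s [^]\<^bsub>S\<^esub> n)"
  by (induction n) (simp_all add: assms pure_one pure_mult)

text \<open>The point is linearity over p^e-th powers of arbitrary elements of \<open>Q\<close>. The
  elements that commute with \<open>\<phi>\<close> form a subgroup containing the p^e-th powers of
  pure tensors. Its preimage under the e-th Frobenius, which is additive, is a subgroup that
  contains all pure tensors, hence all of \<open>Q\<close>.\<close>

lemma tensor_diff_op: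
  assumes \<alpha>: "\<alpha> \<in> diff_ops p e R" and \<beta>: "\<beta> \<in> diff_ops p e S"
  obtains \<phi> where "\<phi> \<in> diff_ops p e Q"
    "\<And>r s. r \<in> carrier R \<Longrightarrow> s \<in> carrier S \<Longrightarrow> \<phi> (r \<diamondop> s) = \<alpha> r \<diamondop> \<beta> s"
proof -
  note \<alpha>h = additive_mapD[OF R.ring_axioms R.ring_axioms diff_opsD(1)[OF \<alpha>]]
  note \<beta>h = additive_mapD[OF S.ring_axioms S.ring_axioms diff_opsD(1)[OF \<beta>]]
  obtain \<phi> where \<phi>: "\<phi> \<in> hom (add_monoid Q) (add_monoid Q)"
    "\<And>r s. r \<in> carrier R \<Longrightarrow> s \<in> carrier S \<Longrightarrow> \<phi> (r \<diamondop> s) = \<alpha> r \<diamondop> \<beta> s"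
    by (rule tensor_lift[OF Q.ring_axioms, of "\<lambda>r s. \<alpha> r \<diamondop> \<beta> s"])
      (simp_all add: \<alpha>h \<beta>h pure_add_left pure_add_right)
  note \<phi>h = additive_mapD[OF Q.ring_axioms Q.ring_axioms \<phi>(1)]
  let ?H = "{b \<in> carrier Q. \<forall>x\<in>carrier Q. \<phi> (b \<otimes>\<^bsub>Q\<^esub> x) = b \<otimes>\<^bsub>Q\<^esub> \<phi> x}"
  have H: "subgroup ?H (add_monoid Q)"
    by (rule Q.additive_subgroupI) (auto simp: \<phi>h Q.l_distr Q.l_minus)
  have frob_pure: "(r \<diamondop> s) [^]\<^bsub>Q\<^esub> (p ^ e) \<in> ?H" if rs: "r \<in> carrier R" "s \<in> carrier S" for r s
  proof -
    let ?b = "(r \<diamondop> s) [^]\<^bsub>Q\<^esub> (p ^ e)"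
    have b: "?b \<in> carrier Q" using rs by simp
    have fr: "r [^]\<^bsub>R\<^esub> (p ^ e) \<in> frob_powers p e R" "s [^]\<^bsub>S\<^esub> (p ^ e) \<in> frob_powers p e S"
      using rs by (auto simp: frob_powers_def)
    have "\<phi> (?b \<otimes>\<^bsub>Q\<^esub> x) = ?b \<otimes>\<^bsub>Q\<^esub> \<phi> x" if "x \<in> carrier Q" for x
    proof (rule tensor_hom_eqI[OF Q.ring_axioms _ _ _ that])
      show "(\<lambda>x. \<phi> (?b \<otimes>\<^bsub>Q\<^esub> x)) \<in> hom (add_monoid Q) (add_monoid Q)"
        by (rule additive_mapI) (use b in \<open>simp_all add: \<phi>h Q.r_distr\<close>)
      show "(\<lambda>x. ?b \<otimes>\<^bsub>Q\<^esub> \<phi> x) \<in> hom (add_monoid Q) (add_monoid Q)"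
        by (rule additive_mapI) (use b in \<open>simp_all add: \<phi>h Q.r_distr\<close>)
      show "\<phi> (?b \<otimes>\<^bsub>Q\<^esub> (r' \<diamondop> s')) = ?b \<otimes>\<^bsub>Q\<^esub> \<phi> (r' \<diamondop> s')" if "r' \<in> carrier R" "s' \<in> carrier S" for r' s'
        using that rs fr by (simp add: pure_pow pure_mult \<phi>(2) diff_opsD(2)[OF \<alpha>] diff_opsD(2)[OF \<beta>] \<alpha>h \<beta>h)
    qed
    then show ?thesis using b by simp
  qed
  have frob: "z [^]\<^bsub>Q\<^esub> (p ^ e) \<in> ?H" if z: "z \<in> carrier Q" for z
  proof -
    have "(\<lambda>z. z [^]\<^bsub>Q\<^esub> (p ^ e)) \<in> hom (add_monoid Q) (add_monoid Q)"
      by (rule additive_mapI) (simp_all add: Q.frobenius_pow_add[OF p char_Q])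
    from tensor_subgroup_induct[OF additive_vimage_subgroup[OF Q.ring_axioms Q.ring_axioms this H] _ z]
    show ?thesis using frob_pure by auto
  qed
  have "\<phi> \<in> diff_ops p e Q"
    by (rule diff_opsI[OF \<phi>(1)]) (use frob in \<open>auto simp: frob_powers_def\<close>)
  then show thesis using that \<phi>(2) by blast
qed

text \<open>Fix \<open>b\<close> and a functional on \<open>S\<close> with contraction
  \<open>f\<close>. Then r \<mapsto> f (\<phi> (r \<diamondop> b)) is an operator of level
  \<open>e\<close> on \<open>R\<close>, so it sends \<open>a\<close> into D A; the same holds with
  the factors exchanged. All contractions of \<open>\<phi> (a \<diamondop> b)\<close> thus land in
  the right ideals, which is the criterion of \<open>mem_tensor_span_prod\<close>.\<close>

lemma diff_op_pure_mem:
  assumes \<phi>: "\<phi> \<in> diff_ops p e Q" and A: "ideal A R" and B: "ideal B S" and a: "a \<in> A" and b: "b \<in> B"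
  shows "\<phi> (a \<diamondop> b) \<in> tensor_span (diff_ops_ideal p e R A \<times> diff_ops_ideal p e S B)"
proof -
  have AR: "A \<subseteq> carrier R" and BS: "B \<subseteq> carrier S" using ideal.Icarr[OF A] ideal.Icarr[OF B] by auto
  have ac: "a \<in> carrier R" "b \<in> carrier S" using AR BS a b by auto
  note \<phi>h = additive_mapD[OF Q.ring_axioms Q.ring_axioms diff_opsD(1)[OF \<phi>]]
  have frob: "x \<diamondop> \<one>\<^bsub>S\<^esub> \<in> frob_powers p e Q" if x: "x \<in> frob_powers p e R" for x
  proof -
    obtain y where y: "y \<in> carrier R" "x = y [^]\<^bsub>R\<^esub> (p ^ e)" using x by (auto simp: frob_powers_def)
    then have "x \<diamondop> \<one>\<^bsub>S\<^esub> = (y \<diamondop> \<one>\<^bsub>S\<^esub>) [^]\<^bsub>Q\<^esub> (p ^ e)" by (simp add: pure_pow)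
    then show ?thesis using y by (auto simp: frob_powers_def)
  qed
  have frob': "\<one>\<^bsub>R\<^esub> \<diamondop> x \<in> frob_powers p e Q" if x: "x \<in> frob_powers p e S" for x
  proof -
    obtain y where y: "y \<in> carrier S" "x = y [^]\<^bsub>S\<^esub> (p ^ e)" using x by (auto simp: frob_powers_def)
    then have "\<one>\<^bsub>R\<^esub> \<diamondop> x = (\<one>\<^bsub>R\<^esub> \<diamondop> y) [^]\<^bsub>Q\<^esub> (p ^ e)" by (simp add: pure_pow)
    then show ?thesis using y by (auto simp: frob_powers_def)
  qed
  show ?thesis
  proof (rule mem_tensor_span_prod)
    show "\<phi> (a \<diamondop> b) \<in> carrier Q" using ac \<phi>h by simp
    show "subgroup (diff_ops_ideal p e R A) (add_monoid R)"
      by (rule ideal_add_subgroup[OF R.diff_ops_ideal_ideal[OF AR]])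
    show "subgroup (diff_ops_ideal p e S B) (add_monoid S)"
      by (rule ideal_add_subgroup[OF S.diff_ops_ideal_ideal[OF BS]])
  next
    fix l f assume l: "fp_functional p S l" and f: "f \<in> hom (add_monoid Q) (add_monoid R)"
      and fl: "\<And>r s. r \<in> carrier R \<Longrightarrow> s \<in> carrier S \<Longrightarrow> f (r \<diamondop> s) = [(l s)] \<cdot>\<^bsub>R\<^esub> r"
    note fh = additive_mapD[OF Q.ring_axioms R.ring_axioms f]
    \<comment> \<open>The contraction is linear over all of \<open>R\<close>, so a p^e-th power
      pulled out of \<open>\<phi>\<close> also passes through \<open>f\<close>.\<close>
    have lin: "f ((x \<diamondop> \<one>\<^bsub>S\<^esub>) \<otimes>\<^bsub>Q\<^esub> w) = x \<otimes>\<^bsub>R\<^esub> f w" if x: "x \<in> carrier R" and w: "w \<in> carrier Q" for x w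
    proof (rule tensor_hom_eqI[OF R.ring_axioms _ _ _ w])
      show "(\<lambda>w. f ((x \<diamondop> \<one>\<^bsub>S\<^esub>) \<otimes>\<^bsub>Q\<^esub> w)) \<in> hom (add_monoid Q) (add_monoid R)"
        by (rule additive_mapI) (use x in \<open>simp_all add: fh Q.r_distr\<close>)
      show "(\<lambda>w. x \<otimes>\<^bsub>R\<^esub> f w) \<in> hom (add_monoid Q) (add_monoid R)"
        by (rule additive_mapI) (use x in \<open>simp_all add: fh R.r_distr\<close>)
      show "f ((x \<diamondop> \<one>\<^bsub>S\<^esub>) \<otimes>\<^bsub>Q\<^esub> (r \<diamondop> s)) = x \<otimes>\<^bsub>R\<^esub> f (r \<diamondop> s)" if "r \<in> carrier R" "s \<in> carrier S" for r s
        using that x by (simp add: pure_mult fl R.add_pow_rdistr_int)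
    qed
    have "(\<lambda>r. f (\<phi> (r \<diamondop> b))) \<in> diff_ops p e R"
    proof (rule diff_opsI)
      show "(\<lambda>r. f (\<phi> (r \<diamondop> b))) \<in> hom (add_monoid R) (add_monoid R)"
        by (rule additive_mapI) (use ac in \<open>simp_all add: fh \<phi>h pure_add_left\<close>)
      fix x r assume x: "x \<in> frob_powers p e R" and r: "r \<in> carrier R"
      have xc: "x \<in> carrier R" using x R.frob_powers_carrier by auto
      have "(x \<otimes>\<^bsub>R\<^esub> r) \<diamondop> b = (x \<diamondop> \<one>\<^bsub>S\<^esub>) \<otimes>\<^bsub>Q\<^esub> (r \<diamondop> b)" using xc r ac by (simp add: pure_mult)
      then show "f (\<phi> ((x \<otimes>\<^bsub>R\<^esub> r) \<diamondop> b)) = x \<otimes>\<^bsub>R\<^esub> f (\<phi> (r \<diamondop> b))"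
        using diff_opsD(2)[OF \<phi> frob[OF x], of "r \<diamondop> b"] lin[OF xc, of "\<phi> (r \<diamondop> b)"] r ac \<phi>h by simp
    qed
    from R.diff_ops_ideal_gen[OF AR this a] show "f (\<phi> (a \<diamondop> b)) \<in> diff_ops_ideal p e R A" .
  next
    fix l f assume l: "fp_functional p R l" and f: "f \<in> hom (add_monoid Q) (add_monoid S)"
      and fl: "\<And>r s. r \<in> carrier R \<Longrightarrow> s \<in> carrier S \<Longrightarrow> f (r \<diamondop> s) = [(l r)] \<cdot>\<^bsub>S\<^esub> s"
    note fh = additive_mapD[OF Q.ring_axioms S.ring_axioms f]
    have lin: "f ((\<one>\<^bsub>R\<^esub> \<diamondop> x) \<otimes>\<^bsub>Q\<^esub> w) = x \<otimes>\<^bsub>S\<^esub> f w" if x: "x \<in> carrier S" and w: "w \<in> carrier Q" for x w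
    proof (rule tensor_hom_eqI[OF S.ring_axioms _ _ _ w])
      show "(\<lambda>w. f ((\<one>\<^bsub>R\<^esub> \<diamondop> x) \<otimes>\<^bsub>Q\<^esub> w)) \<in> hom (add_monoid Q) (add_monoid S)"
        by (rule additive_mapI) (use x in \<open>simp_all add: fh Q.r_distr\<close>)
      show "(\<lambda>w. x \<otimes>\<^bsub>S\<^esub> f w) \<in> hom (add_monoid Q) (add_monoid S)"
        by (rule additive_mapI) (use x in \<open>simp_all add: fh S.r_distr\<close>)
      show "f ((\<one>\<^bsub>R\<^esub> \<diamondop> x) \<otimes>\<^bsub>Q\<^esub> (r \<diamondop> s)) = x \<otimes>\<^bsub>S\<^esub> f (r \<diamondop> s)" if "r \<in> carrier R" "s \<in> carrier S" for r s
        using that x by (simp add: pure_mult fl S.add_pow_rdistr_int)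
    qed
    have "(\<lambda>s. f (\<phi> (a \<diamondop> s))) \<in> diff_ops p e S"
    proof (rule diff_opsI)
      show "(\<lambda>s. f (\<phi> (a \<diamondop> s))) \<in> hom (add_monoid S) (add_monoid S)"
        by (rule additive_mapI) (use ac in \<open>simp_all add: fh \<phi>h pure_add_right\<close>)
      fix x s assume x: "x \<in> frob_powers p e S" and s: "s \<in> carrier S"
      have xc: "x \<in> carrier S" using x S.frob_powers_carrier by auto
      have "a \<diamondop> (x \<otimes>\<^bsub>S\<^esub> s) = (\<one>\<^bsub>R\<^esub> \<diamondop> x) \<otimes>\<^bsub>Q\<^esub> (a \<diamondop> s)" using xc s ac by (simp add: pure_mult)
      then show "f (\<phi> (a \<diamondop> (x \<otimes>\<^bsub>S\<^esub> s))) = x \<otimes>\<^bsub>S\<^esub> f (\<phi> (a \<diamondop> s))"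
        using diff_opsD(2)[OF \<phi> frob'[OF x], of "a \<diamondop> s"] lin[OF xc, of "\<phi> (a \<diamondop> s)"] s ac \<phi>h by simp
    qed
    from S.diff_ops_ideal_gen[OF BS this b] show "f (\<phi> (a \<diamondop> b)) \<in> diff_ops_ideal p e S B" .
  qed
qed

section \<open>Operators applied to sums of tensor products of ideals\<close>

lemma prod_family_carrier:
  assumes "\<And>i. ideal (A i) R" "\<And>i. ideal (B i) S"
  shows "(\<Union>i\<in>C. A i \<times> B i) \<subseteq> X"
  using ideal.Icarr[OF assms(1)] ideal.Icarr[OF assms(2)] by blast

lemma prod_family_ideal:
  assumes "\<And>i. ideal (A i) R" "\<And>i. ideal (B i) S"
  shows "ideal (tensor_span (\<Union>i\<in>C. A i \<times> B i)) Q"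
  by (rule tensor_span_ideal[OF prod_family_carrier[OF assms]])
    (auto intro: ideal.I_l_closed assms)

text \<open>\<open>diff_op_pure_mem\<close> bounds the left-hand side on generators. For the
  converse, the operators \<phi> \<otimes> \<psi> yield only the tensors
  \<open>\<phi> g \<diamondop> \<psi> h\<close>, whereas D A and D B are the ideals generated by
  such values; so the two factors are completed to the full ideals one after the other.\<close>

lemma diff_ops_ideal_tensor_span:
  assumes A: "\<And>i. ideal (A i) R" and B: "\<And>i. ideal (B i) S"
  shows "diff_ops_ideal p e Q (tensor_span (\<Union>i\<in>C. A i \<times> B i)) =
    tensor_span (\<Union>i\<in>C. diff_ops_ideal p e R (A i) \<times> diff_ops_ideal p e S (B i))"
    (is "?D = tensor_span ?T")
proof
  have AR: "A i \<subseteq> carrier R" and BS: "B i \<subseteq> carrier S" for i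
    using ideal.Icarr[OF A] ideal.Icarr[OF B] by auto
  note DA = R.diff_ops_ideal_ideal[OF AR] and DB = S.diff_ops_ideal_ideal[OF BS]
  have T: "?T \<subseteq> X" by (rule prod_family_carrier[OF DA DB])
  note K = prod_family_ideal[of A B C, OF A B]
  have KQ: "tensor_span (\<Union>i\<in>C. A i \<times> B i) \<subseteq> carrier Q" using ideal.Icarr[OF K] by blast
  have D: "ideal ?D Q" by (rule Q.diff_ops_ideal_ideal[OF KQ])
  have Dsub: "subgroup ?D (add_monoid Q)" by (rule ideal_add_subgroup[OF D])
  show "?D \<subseteq> tensor_span ?T"
  proof (rule Q.diff_ops_ideal_minimal[OF prod_family_ideal[OF DA DB]])
    fix \<phi> g assume \<phi>: "\<phi> \<in> diff_ops p e Q" and g: "g \<in> tensor_span (\<Union>i\<in>C. A i \<times> B i)"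
    have "tensor_span (\<Union>i\<in>C. A i \<times> B i) \<subseteq> {w \<in> carrier Q. \<phi> w \<in> tensor_span ?T}"
    proof (rule tensor_span_minimal)
      show "subgroup {w \<in> carrier Q. \<phi> w \<in> tensor_span ?T} (add_monoid Q)"
        by (rule additive_vimage_subgroup[OF Q.ring_axioms Q.ring_axioms diff_opsD(1)[OF \<phi>] tensor_span_subgroup[OF T]])
      fix r s assume "(r, s) \<in> (\<Union>i\<in>C. A i \<times> B i)"
      then obtain i where i: "i \<in> C" "r \<in> A i" "s \<in> B i" by blast
      have "\<phi> (r \<diamondop> s) \<in> tensor_span (diff_ops_ideal p e R (A i) \<times> diff_ops_ideal p e S (B i))"
        by (rule diff_op_pure_mem[OF \<phi> A B i(2,3)])
      also have "\<dots> \<subseteq> tensor_span ?T" by (rule tensor_span_mono[OF _ T]) (use i in blast)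
      finally show "r \<diamondop> s \<in> {w \<in> carrier Q. \<phi> w \<in> tensor_span ?T}"
        using subsetD[OF AR i(2)] subsetD[OF BS i(3)] by simp
    qed
    then show "\<phi> g \<in> tensor_span ?T" using g by blast
  qed
  show "tensor_span ?T \<subseteq> ?D"
  proof (rule tensor_span_minimal[OF Dsub])
    fix x y assume "(x, y) \<in> ?T"
    then obtain i where i: "i \<in> C" "x \<in> diff_ops_ideal p e R (A i)" "y \<in> diff_ops_ideal p e S (B i)" by blast
    \<comment> \<open>With \<open>\<psi> h\<close> fixed, the first entry is extended from the
      values \<open>\<phi> g\<close> to the ideal that they generate; the second entry follows
      afterwards with \<open>x\<close> fixed.\<close>
    have 1: "diff_ops_ideal p e R (A i) \<subseteq> {r \<in> carrier R. r \<diamondop> \<psi> h \<in> ?D}" if \<psi>: "\<psi> \<in> diff_ops p e S" and h: "h \<in> B i" for \<psi> h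
    proof (rule R.diff_ops_ideal_minimal)
      have c: "\<psi> h \<in> carrier S" using S.diff_ops_closed[OF \<psi>] h BS by auto
      show "ideal {r \<in> carrier R. r \<diamondop> \<psi> h \<in> ?D} R"
      proof (rule R.ideal_from_subgroup[OF additive_vimage_subgroup[OF R.ring_axioms Q.ring_axioms pure_additive(1)[OF c] Dsub]])
        fix r x assume r: "r \<in> carrier R" and x: "x \<in> {r \<in> carrier R. r \<diamondop> \<psi> h \<in> ?D}"
        have "(r \<otimes>\<^bsub>R\<^esub> x) \<diamondop> \<psi> h = (r \<diamondop> \<one>\<^bsub>S\<^esub>) \<otimes>\<^bsub>Q\<^esub> (x \<diamondop> \<psi> h)" using r x c by (simp add: pure_mult)
        then show "r \<otimes>\<^bsub>R\<^esub> x \<in> {r \<in> carrier R. r \<diamondop> \<psi> h \<in> ?D}"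
          using ideal.I_l_closed[OF D, of "x \<diamondop> \<psi> h" "r \<diamondop> \<one>\<^bsub>S\<^esub>"] r x by simp
      qed
      fix \<phi> g assume \<phi>: "\<phi> \<in> diff_ops p e R" and g: "g \<in> A i"
      obtain \<chi> where \<chi>: "\<chi> \<in> diff_ops p e Q"
        "\<And>r s. r \<in> carrier R \<Longrightarrow> s \<in> carrier S \<Longrightarrow> \<chi> (r \<diamondop> s) = \<phi> r \<diamondop> \<psi> s"
        using tensor_diff_op[OF \<phi> \<psi>] by blast
      have "g \<diamondop> h \<in> tensor_span (\<Union>i\<in>C. A i \<times> B i)" using g h i by (intro tensor_span_incl) blast
      then have "\<chi> (g \<diamondop> h) \<in> ?D" by (rule Q.diff_ops_ideal_gen[OF KQ \<chi>(1)])
      then show "\<phi> g \<in> {r \<in> carrier R. r \<diamondop> \<psi> h \<in> ?D}"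
        using \<chi>(2)[of g h] subsetD[OF AR g] subsetD[OF BS h] R.diff_ops_closed[OF \<phi>, of g] by simp
    qed
    have xc: "x \<in> carrier R" using ideal.Icarr[OF DA i(2)] .
    have "diff_ops_ideal p e S (B i) \<subseteq> {s \<in> carrier S. x \<diamondop> s \<in> ?D}"
    proof (rule S.diff_ops_ideal_minimal)
      show "ideal {s \<in> carrier S. x \<diamondop> s \<in> ?D} S"
      proof (rule S.ideal_from_subgroup[OF additive_vimage_subgroup[OF S.ring_axioms Q.ring_axioms pure_additive(2)[OF xc] Dsub]])
        fix r s assume r: "r \<in> carrier S" and s: "s \<in> {s \<in> carrier S. x \<diamondop> s \<in> ?D}"
        have "x \<diamondop> (r \<otimes>\<^bsub>S\<^esub> s) = (\<one>\<^bsub>R\<^esub> \<diamondop> r) \<otimes>\<^bsub>Q\<^esub> (x \<diamondop> s)" using r s xc by (simp add: pure_mult)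
        then show "r \<otimes>\<^bsub>S\<^esub> s \<in> {s \<in> carrier S. x \<diamondop> s \<in> ?D}"
          using ideal.I_l_closed[OF D, of "x \<diamondop> s" "\<one>\<^bsub>R\<^esub> \<diamondop> r"] r s by simp
      qed
      show "\<psi> h \<in> {s \<in> carrier S. x \<diamondop> s \<in> ?D}" if "\<psi> \<in> diff_ops p e S" "h \<in> B i" for \<psi> h
        using 1[OF that] i(2) S.diff_ops_closed[OF that(1), of h] BS[of i] that(2) by auto
    qed
    then show "x \<diamondop> y \<in> ?D" using i(3) by blast
  qed
qed

section \<open>Powers of the sum and product ideals\<close>

lemma sum_ideal_eq:
  assumes I: "ideal I R" and J: "ideal J S"
  shows "sum_ideal p R S I J = tensor_span (I \<times> carrier S \<union> carrier R \<times> J)"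
proof -
  have IJ: "I \<subseteq> carrier R" "J \<subseteq> carrier S" using ideal.Icarr[OF I] ideal.Icarr[OF J] by auto
  let ?G = "{f \<diamondop> \<one>\<^bsub>S\<^esub> | f. f \<in> I} \<union> {\<one>\<^bsub>R\<^esub> \<diamondop> g | g. g \<in> J}"
  have G: "?G \<subseteq> carrier Q" using IJ by auto
  let ?T = "I \<times> carrier S \<union> carrier R \<times> J"
  have T: "?T \<subseteq> X" using IJ by blast
  note Gi = Q.genideal_ideal[OF G]
  have "tensor_span ?T \<subseteq> Idl\<^bsub>Q\<^esub> ?G"
  proof (rule tensor_span_minimal)
    show "subgroup (Idl\<^bsub>Q\<^esub> ?G) (add_monoid Q)" by (rule ideal_add_subgroup[OF Gi])
    fix r s assume rs: "(r, s) \<in> ?T"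
    then have c: "r \<in> carrier R" "s \<in> carrier S" using T by auto
    have "r \<diamondop> s = (\<one>\<^bsub>R\<^esub> \<diamondop> s) \<otimes>\<^bsub>Q\<^esub> (r \<diamondop> \<one>\<^bsub>S\<^esub>)" "r \<diamondop> s = (r \<diamondop> \<one>\<^bsub>S\<^esub>) \<otimes>\<^bsub>Q\<^esub> (\<one>\<^bsub>R\<^esub> \<diamondop> s)"
      using c by (simp_all add: pure_mult)
    moreover have "r \<diamondop> \<one>\<^bsub>S\<^esub> \<in> Idl\<^bsub>Q\<^esub> ?G \<or> \<one>\<^bsub>R\<^esub> \<diamondop> s \<in> Idl\<^bsub>Q\<^esub> ?G"
      using rs Q.genideal_self[OF G] by blast
    ultimately show "r \<diamondop> s \<in> Idl\<^bsub>Q\<^esub> ?G"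
      using ideal.I_l_closed[OF Gi, of "r \<diamondop> \<one>\<^bsub>S\<^esub>" "\<one>\<^bsub>R\<^esub> \<diamondop> s"]
        ideal.I_l_closed[OF Gi, of "\<one>\<^bsub>R\<^esub> \<diamondop> s" "r \<diamondop> \<one>\<^bsub>S\<^esub>"] c by fastforce
  qed
  moreover have "Idl\<^bsub>Q\<^esub> ?G \<subseteq> tensor_span ?T"
  proof (rule Q.genideal_minimal)
    show "ideal (tensor_span ?T) Q"
      by (rule tensor_span_ideal[OF T]) (auto intro: ideal.I_l_closed I J)
    show "?G \<subseteq> tensor_span ?T" by (auto intro!: tensor_span_incl)
  qed
  ultimately show ?thesis unfolding sum_ideal_def by blast
qed

lemma product_ideal_eq:
  assumes I: "ideal I R" and J: "ideal J S"
  shows "product_ideal p R S I J = tensor_span (I \<times> J)"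
proof -
  have T: "I \<times> J \<subseteq> X" using ideal.Icarr[OF I] ideal.Icarr[OF J] by auto
  let ?G = "{f \<diamondop> g | f g. f \<in> I \<and> g \<in> J}"
  have G: "?G \<subseteq> carrier Q" using T by auto
  have "tensor_span (I \<times> J) \<subseteq> Idl\<^bsub>Q\<^esub> ?G"
  proof (rule tensor_span_minimal)
    show "subgroup (Idl\<^bsub>Q\<^esub> ?G) (add_monoid Q)"
      by (rule ideal_add_subgroup[OF Q.genideal_ideal[OF G]])
  qed (use Q.genideal_self[OF G] in blast)
  moreover have "Idl\<^bsub>Q\<^esub> ?G \<subseteq> tensor_span (I \<times> J)"
    by (intro Q.genideal_minimal tensor_span_ideal[OF T])
      (auto intro: ideal.I_l_closed I J tensor_span_incl)
  ultimately show ?thesis unfolding product_ideal_def by blast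
qed

text \<open>Elements of an ideal product are sums of products, so the claim is reduced in each
  factor in turn to single products, for which the tensor splits as a product in \<open>Q\<close>.
  It gives the inclusion of the span in the ideal product in both power formulas.\<close>

lemma pure_ideal_prod_mem:
  assumes L: "subgroup L (add_monoid Q)" and A: "ideal A R" "ideal A' R" and B: "ideal B S" "ideal B' S"
    and r: "r \<in> ideal_prod R A A'" and s: "s \<in> ideal_prod S B B'"
    and prod: "\<And>a a' b b'. a \<in> A \<Longrightarrow> a' \<in> A' \<Longrightarrow> b \<in> B \<Longrightarrow> b' \<in> B' \<Longrightarrow>
      (a \<diamondop> b) \<otimes>\<^bsub>Q\<^esub> (a' \<diamondop> b') \<in> L"
  shows "r \<diamondop> s \<in> L"
proof -
  have 1: "r \<in> {r \<in> carrier R. r \<diamondop> (b \<otimes>\<^bsub>S\<^esub> b') \<in> L}" if b: "b \<in> B" "b' \<in> B'" for b b'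
  proof (rule ideal_prod_induct[OF r])
    have bc: "b \<in> carrier S" "b' \<in> carrier S" using ideal.Icarr[OF B(1) b(1)] ideal.Icarr[OF B(2) b(2)] by auto
    then have "b \<otimes>\<^bsub>S\<^esub> b' \<in> carrier S" by simp
    from additive_vimage_subgroup[OF R.ring_axioms Q.ring_axioms pure_additive(1)[OF this] L]
    show "subgroup {r \<in> carrier R. r \<diamondop> (b \<otimes>\<^bsub>S\<^esub> b') \<in> L} (add_monoid R)" .
    show "a \<otimes>\<^bsub>R\<^esub> a' \<in> {r \<in> carrier R. r \<diamondop> (b \<otimes>\<^bsub>S\<^esub> b') \<in> L}" if a: "a \<in> A" "a' \<in> A'" for a a'
    proof -
      have "a \<in> carrier R" "a' \<in> carrier R" using ideal.Icarr[OF A(1) a(1)] ideal.Icarr[OF A(2) a(2)] by auto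
      then show ?thesis using prod[OF a b] bc by (simp add: pure_mult)
    qed
  qed
  have rc: "r \<in> carrier R" using R.ideal_prod_in_carrier[OF A] r by blast
  have "s \<in> {s \<in> carrier S. r \<diamondop> s \<in> L}"
  proof (rule ideal_prod_induct[OF s])
    show "subgroup {s \<in> carrier S. r \<diamondop> s \<in> L} (add_monoid S)"
      by (rule additive_vimage_subgroup[OF S.ring_axioms Q.ring_axioms pure_additive(2)[OF rc] L])
    show "b \<otimes>\<^bsub>S\<^esub> b' \<in> {s \<in> carrier S. r \<diamondop> s \<in> L}" if b: "b \<in> B" "b' \<in> B'" for b b'
      using 1[OF b] ideal.Icarr[OF B(1) b(1)] ideal.Icarr[OF B(2) b(2)] by simp
  qed
  then show ?thesis by simp
qed

lemma product_ideal_power: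
  assumes I: "ideal I R" and J: "ideal J S"
  shows "product_ideal p R S I J [^]\<^bsub>ideals_set Q\<^esub> (n::nat) =
    tensor_span ((I [^]\<^bsub>ideals_set R\<^esub> n) \<times> (J [^]\<^bsub>ideals_set S\<^esub> n))"
proof (induction n)
  case 0
  show ?case unfolding ideal_power_0 tensor_span_carrier ..
next
  case (Suc n)
  let ?I = "\<lambda>n. I [^]\<^bsub>ideals_set R\<^esub> (n::nat)" and ?J = "\<lambda>n. J [^]\<^bsub>ideals_set S\<^esub> (n::nat)"
  note Ii = R.ideal_power_ideal[OF I] and Ji = S.ideal_power_ideal[OF J]
  have c: "?I n \<times> ?J n \<subseteq> X" for n using ideal.Icarr[OF Ii] ideal.Icarr[OF Ji] by auto
  have c1: "I \<times> J \<subseteq> X" using ideal.Icarr[OF I] ideal.Icarr[OF J] by auto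
  \<comment> \<open>A one-point index set specialises the lemma on families to a single
    product.\<close>
  have id1: "ideal (tensor_span (?I n \<times> ?J n)) Q" for n
    using prod_family_ideal[of "\<lambda>_. ?I n" "\<lambda>_. ?J n" "{()}"] Ii Ji by simp
  have id2: "ideal (tensor_span (I \<times> J)) Q"
    using prod_family_ideal[of "\<lambda>_. I" "\<lambda>_. J" "{()}"] I J by simp
  have "ideal_prod Q (tensor_span (?I n \<times> ?J n)) (tensor_span (I \<times> J)) = tensor_span (?I (Suc n) \<times> ?J (Suc n))"
    (is "?P = ?L")
  proof
    have L: "subgroup ?L (add_monoid Q)" by (rule tensor_span_subgroup[OF c])
    show "?P \<subseteq> ?L"
    proof
      fix x assume "x \<in> ?P"
      then show "x \<in> ?L"
      proof (rule ideal_prod_induct[OF _ L])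
        show "a \<otimes>\<^bsub>Q\<^esub> b \<in> ?L" if "a \<in> tensor_span (?I n \<times> ?J n)" "b \<in> tensor_span (I \<times> J)" for a b
          by (rule tensor_span_mult[OF c c1 L _ that], rule tensor_span_incl)
            (auto simp: ideal_power_Suc simp del: nat_pow_Suc intro: ideal_prod.prod)
      qed
    qed
    have P: "subgroup ?P (add_monoid Q)"
      by (rule ideal_add_subgroup[OF Q.ideal_prod_is_ideal[OF id1 id2]])
    show "?L \<subseteq> ?P"
    proof (rule tensor_span_minimal[OF P])
      fix r s assume "(r, s) \<in> ?I (Suc n) \<times> ?J (Suc n)"
      then have "r \<in> ideal_prod R (?I n) I" "s \<in> ideal_prod S (?J n) J"
        unfolding ideal_power_Suc by auto
      then show "r \<diamondop> s \<in> ?P"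
        by (rule pure_ideal_prod_mem[OF P Ii I Ji J]) (auto intro!: ideal_prod.prod tensor_span_incl)
    qed
  qed
  then show ?case unfolding ideal_power_Suc[where A = Q] unfolding Suc.IH unfolding product_ideal_eq[OF I J] .
qed

lemma sum_ideal_power:
  assumes I: "ideal I R" and J: "ideal J S"
  shows "sum_ideal p R S I J [^]\<^bsub>ideals_set Q\<^esub> (n::nat) =
    tensor_span (\<Union>i\<in>{..n}. (I [^]\<^bsub>ideals_set R\<^esub> i) \<times> (J [^]\<^bsub>ideals_set S\<^esub> (n - i)))"
proof (induction n)
  case 0
  show ?case by (simp only: ideal_power_0 tensor_span_carrier atMost_0 diff_0_eq_0) (simp add: ideal_power_0 tensor_span_carrier del: nat_pow_0)
next
  case (Suc n)
  let ?I = "\<lambda>n. I [^]\<^bsub>ideals_set R\<^esub> (n::nat)" and ?J = "\<lambda>n. J [^]\<^bsub>ideals_set S\<^esub> (n::nat)"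
  let ?T = "\<lambda>n. \<Union>i\<in>{..n}. ?I i \<times> ?J (n - i)" and ?T1 = "I \<times> carrier S \<union> carrier R \<times> J"
  note Ii = R.ideal_power_ideal[OF I] and Ji = S.ideal_power_ideal[OF J]
  have c: "?T n \<subseteq> X" for n by (rule prod_family_carrier[OF Ii Ji])
  have c1: "?T1 \<subseteq> X" using ideal.Icarr[OF I] ideal.Icarr[OF J] by blast
  have id1: "ideal (tensor_span (?T n)) Q" for n by (rule prod_family_ideal[OF Ii Ji])
  have id2: "ideal (tensor_span ?T1) Q"
    by (rule tensor_span_ideal[OF c1]) (auto intro: ideal.I_l_closed I J)
  have "ideal_prod Q (tensor_span (?T n)) (tensor_span ?T1) = tensor_span (?T (Suc n))"
    (is "?P = ?L")
  proof
    have L: "subgroup ?L (add_monoid Q)" by (rule tensor_span_subgroup[OF c])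
    show "?P \<subseteq> ?L"
    proof
      fix x assume "x \<in> ?P"
      then show "x \<in> ?L"
      proof (rule ideal_prod_induct[OF _ L])
        fix a b assume a: "a \<in> tensor_span (?T n)" and b: "b \<in> tensor_span ?T1"
        show "a \<otimes>\<^bsub>Q\<^esub> b \<in> ?L"
        proof (rule tensor_span_mult[OF c c1 L _ a b], rule tensor_span_incl)
          fix r s r' s' assume rs: "(r, s) \<in> ?T n" and rs': "(r', s') \<in> ?T1"
          obtain i where i: "i \<le> n" "r \<in> ?I i" "s \<in> ?J (n - i)" using rs by auto
          from rs' show "(r \<otimes>\<^bsub>R\<^esub> r', s \<otimes>\<^bsub>S\<^esub> s') \<in> ?T (Suc n)"
          proof
            assume "(r', s') \<in> I \<times> carrier S"
            then have "r \<otimes>\<^bsub>R\<^esub> r' \<in> ?I (Suc i)" "s \<otimes>\<^bsub>S\<^esub> s' \<in> ?J (Suc n - Suc i)"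
              using i ideal.I_r_closed[OF Ji i(3)] unfolding ideal_power_Suc by (auto intro: ideal_prod.prod)
            then show ?thesis using i(1) by blast
          next
            assume "(r', s') \<in> carrier R \<times> J"
            then have "r \<otimes>\<^bsub>R\<^esub> r' \<in> ?I i" "s \<otimes>\<^bsub>S\<^esub> s' \<in> ?J (Suc (n - i))"
              using i ideal.I_r_closed[OF Ii i(2)] unfolding ideal_power_Suc by (auto intro: ideal_prod.prod)
            \<comment> \<open>The bound \<open>i \<le> n\<close> keeps the truncated subtraction
              exact.\<close>
            moreover have "Suc (n - i) = Suc n - i" using i(1) by simp
            ultimately have "(r \<otimes>\<^bsub>R\<^esub> r', s \<otimes>\<^bsub>S\<^esub> s') \<in> ?I i \<times> ?J (Suc n - i)" by (simp only: mem_Sigma_iff)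
            moreover have "i \<in> {..Suc n}" using i(1) by simp
            ultimately show ?thesis by blast
          qed
        qed
      qed
    qed
    have P: "subgroup ?P (add_monoid Q)"
      by (rule ideal_add_subgroup[OF Q.ideal_prod_is_ideal[OF id1 id2]])
    show "?L \<subseteq> ?P"
    proof (rule tensor_span_minimal[OF P])
      fix r s assume "(r, s) \<in> ?T (Suc n)"
      then obtain i where i: "i \<le> Suc n" "r \<in> ?I i" "s \<in> ?J (Suc n - i)" by blast
      \<comment> \<open>One factor has to be split off from a term in bidegree (i, n+1-i). For
        \<open>i = 0\<close> there is none in \<open>I\<close>, so it comes from \<open>J\<close>;
        for \<open>i = Suc k\<close> it comes from \<open>I\<close>, which leaves the exponents
        \<open>k\<close> and \<open>n - k\<close>.\<close>
      show "r \<diamondop> s \<in> ?P"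
      proof (cases i)
        case 0
        \<comment> \<open>The whole ring is its own square as an ideal; this puts \<open>r\<close>
          into the shape that \<open>pure_ideal_prod_mem\<close> expects.\<close>
        have "r \<in> ideal_prod R (carrier R) (carrier R)"
          using i(2) ideal.Icarr[OF Ii] R.ideal_prod_one[OF R.oneideal] by auto
        moreover have "s \<in> ideal_prod S (?J n) J" using i(3) unfolding 0 minus_nat.diff_0 ideal_power_Suc .
        ultimately show ?thesis
        proof (rule pure_ideal_prod_mem[OF P R.oneideal R.oneideal Ji J])
          fix a a' b b' assume ab: "a \<in> carrier R" "a' \<in> carrier R" "b \<in> ?J n" "b' \<in> J"
          have "(a, b) \<in> ?I 0 \<times> ?J (n - 0)" using ab by (simp only: ideal_power_0 mem_Sigma_iff minus_nat.diff_0)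
          then have "(a, b) \<in> ?T n" by blast
          then show "(a \<diamondop> b) \<otimes>\<^bsub>Q\<^esub> (a' \<diamondop> b') \<in> ?P"
            using ab by (intro ideal_prod.prod tensor_span_incl) auto
        qed
      next
        case (Suc k)
        have "r \<in> ideal_prod R (?I k) I" using i(2) unfolding Suc ideal_power_Suc .
        moreover have "s \<in> ideal_prod S (?J (n - k)) (carrier S)"
          using i(3) unfolding Suc diff_Suc_Suc S.ideal_prod_one[OF Ji] .
        ultimately show ?thesis
        proof (rule pure_ideal_prod_mem[OF P Ii I Ji S.oneideal])
          fix a a' b b' assume ab: "a \<in> ?I k" "a' \<in> I" "b \<in> ?J (n - k)" "b' \<in> carrier S"
          have "k \<in> {..n}" using i(1) Suc by simp
          then have "(a, b) \<in> ?T n" using ab by blast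
          then show "(a \<diamondop> b) \<otimes>\<^bsub>Q\<^esub> (a' \<diamondop> b') \<in> ?P"
            using ab by (intro ideal_prod.prod tensor_span_incl) auto
        qed
      qed
    qed
  qed
  then show ?case unfolding ideal_power_Suc[where A = Q] unfolding Suc.IH unfolding sum_ideal_eq[OF I J] .
qed

section \<open>Jumps of the sum and product ideals\<close>

lemma sum_ideal_ideal: "ideal I R \<Longrightarrow> ideal J S \<Longrightarrow> ideal (sum_ideal p R S I J) Q"
  unfolding sum_ideal_def
  using ideal.Icarr[of I R] ideal.Icarr[of J S] by (intro Q.genideal_ideal) auto

lemma product_ideal_ideal: "ideal I R \<Longrightarrow> ideal J S \<Longrightarrow> ideal (product_ideal p R S I J) Q"
  unfolding product_ideal_def
  using ideal.Icarr[of I R] ideal.Icarr[of J S] by (intro Q.genideal_ideal) auto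

text \<open>A generator in bidegree (i, n-i) is compared with the two neighbouring pairs (i+1, n-i)
  and (i, n+1-i) of degree n+1, which forces both factors to jump. Conversely, if n = i + j, every
  pair (k, n+1-k) has k > i or n+1-k > j, so the tensor of the witnesses for two jumps is separated
  from the next ideal.\<close>

lemma nu_invariants_sum_ideal:
  assumes I: "ideal I R" and J: "ideal J S"
  shows "nu_invariants p Q (sum_ideal p R S I J) e =
    {n + m | n m. n \<in> nu_invariants p R I e \<and> m \<in> nu_invariants p S J e}"
proof -
  let ?I = "\<lambda>n. I [^]\<^bsub>ideals_set R\<^esub> (n::nat)" and ?J = "\<lambda>n. J [^]\<^bsub>ideals_set S\<^esub> (n::nat)"
  let ?a = "\<lambda>n. diff_ops_ideal p e R (?I n)" and ?b = "\<lambda>n. diff_ops_ideal p e S (?J n)"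
  let ?T = "\<lambda>n. \<Union>i\<in>{..n}. ?I i \<times> ?J (n - i)" and ?U = "\<lambda>n. \<Union>i\<in>{..n}. ?a i \<times> ?b (n - i)"
  note Ii = R.ideal_power_ideal[OF I] and Ji = S.ideal_power_ideal[OF J]
  note Ic = R.ideal_power_carrier[OF I] and Jc = S.ideal_power_carrier[OF J]
  note ai = R.diff_ops_ideal_ideal[OF Ic] and bi = S.diff_ops_ideal_ideal[OF Jc]
  have U: "?U n \<subseteq> X" for n by (rule prod_family_carrier[OF ai bi])
  have a_anti: "?a j \<subseteq> ?a i" if "i \<le> j" for i j
    by (rule lift_Suc_antimono_le[of ?a, OF _ that])
      (rule R.diff_ops_ideal_mono[OF order_refl R.ideal_power_Suc_subset[OF I] Ic])
  have b_anti: "?b j \<subseteq> ?b i" if "i \<le> j" for i j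
    by (rule lift_Suc_antimono_le[of ?b, OF _ that])
      (rule S.diff_ops_ideal_mono[OF order_refl S.ideal_power_Suc_subset[OF J] Jc])
  have nu: "n \<in> nu_invariants p Q (sum_ideal p R S I J) e \<longleftrightarrow> \<not> tensor_span (?T n) \<subseteq> tensor_span (?U (Suc n))" for n
    unfolding Q.nu_invariants_iff[OF sum_ideal_ideal[OF I J]] sum_ideal_power[OF I J]
      diff_ops_ideal_tensor_span[OF Ii Ji] ..
  show ?thesis
  proof (intro equalityI subsetI)
    fix n assume "n \<in> nu_invariants p Q (sum_ideal p R S I J) e"
    \<comment> \<open>A span lies in a subgroup as soon as its generators do, so the failure of
      containment already shows at a pure tensor.\<close>
    then obtain x y where xy: "(x, y) \<in> ?T n" "x \<diamondop> y \<notin> tensor_span (?U (Suc n))"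
      using tensor_span_minimal[OF tensor_span_subgroup[OF U[of "Suc n"]], of "?T n"] unfolding nu by blast
    then obtain i where i: "i \<le> n" "x \<in> ?I i" "y \<in> ?J (n - i)" by blast
    have mem: "(x, y) \<notin> ?a k \<times> ?b (Suc n - k)" if "k \<le> Suc n" for k
      using xy(2) tensor_span_incl[of x y "?U (Suc n)"] that by blast
    \<comment> \<open>The pair with \<open>k = Suc i\<close> has second exponent
      \<open>n - i\<close>, and \<open>y\<close> belongs to that ideal already; so the failure must
      come from \<open>x\<close>.\<close>
    have "x \<notin> ?a (Suc i)"
      using mem[of "Suc i"] i S.diff_ops_ideal_subset[OF Jc, of "n - i" p e] by auto
    moreover have "y \<notin> ?b (Suc (n - i))"
      using mem[of i] i R.diff_ops_ideal_subset[OF Ic, of i p e] by (auto simp: Suc_diff_le)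
    ultimately have "i \<in> nu_invariants p R I e" "n - i \<in> nu_invariants p S J e"
      unfolding R.nu_invariants_iff[OF I] S.nu_invariants_iff[OF J] using i by blast+
    moreover have "n = i + (n - i)" using i(1) by simp
    ultimately show "n \<in> {n + m | n m. n \<in> nu_invariants p R I e \<and> m \<in> nu_invariants p S J e}" by blast
  next
    fix n assume "n \<in> {n + m | n m. n \<in> nu_invariants p R I e \<and> m \<in> nu_invariants p S J e}"
    then obtain i j where n: "n = i + j" and ij: "i \<in> nu_invariants p R I e" "j \<in> nu_invariants p S J e" by blast
    obtain x y where x: "x \<in> ?I i" "x \<notin> ?a (Suc i)" and y: "y \<in> ?J j" "y \<notin> ?b (Suc j)"
      using ij unfolding R.nu_invariants_iff[OF I] S.nu_invariants_iff[OF J] by blast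
    have "x \<diamondop> y \<notin> tensor_span (?U (Suc n))"
    proof (rule pure_notin_span[OF U _ _ _ x(2) _ y(2)])
      show "subgroup (?a (Suc i)) (add_monoid R)" by (rule ideal_add_subgroup[OF ai])
      show "subgroup (?b (Suc j)) (add_monoid S)" by (rule ideal_add_subgroup[OF bi])
      show "x \<in> carrier R" "y \<in> carrier S" using x(1) y(1) Ic Jc by blast+
      fix r s assume "(r, s) \<in> ?U (Suc n)"
      then obtain k where k: "r \<in> ?a k" "s \<in> ?b (Suc n - k)" by blast
      show "r \<in> ?a (Suc i) \<or> s \<in> ?b (Suc j)"
      proof (cases "Suc i \<le> k")
        case True
        then show ?thesis using a_anti k(1) by blast
      next
        case False
        then have "Suc j \<le> Suc n - k" using n by simp
        then show ?thesis using b_anti k(2) by blast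
      qed
    qed
    moreover have "x \<diamondop> y \<in> tensor_span (?T n)"
    proof (rule tensor_span_incl)
      have "(x, y) \<in> ?I i \<times> ?J (n - i)" using x(1) y(1) n by simp
      moreover have "i \<in> {..n}" using n by simp
      ultimately show "(x, y) \<in> ?T n" by blast
    qed
    ultimately show "n \<in> nu_invariants p Q (sum_ideal p R S I J) e" unfolding nu by blast
  qed
qed

text \<open>The span in degree n+1 comes from a single product of two ideals, so a pure tensor
  outside it has a factor outside its ideal. Conversely one jump is enough, with any nonzero element
  of the same power of the other ideal as partner.\<close>

lemma nu_invariants_product_ideal:
  assumes I: "ideal I R" and J: "ideal J S"
    and nI: "\<And>n. \<exists>x\<in>I [^]\<^bsub>ideals_set R\<^esub> (n::nat). x \<noteq> \<zero>\<^bsub>R\<^esub>"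
    and nJ: "\<And>n. \<exists>x\<in>J [^]\<^bsub>ideals_set S\<^esub> (n::nat). x \<noteq> \<zero>\<^bsub>S\<^esub>"
  shows "nu_invariants p Q (product_ideal p R S I J) e = nu_invariants p R I e \<union> nu_invariants p S J e"
proof -
  let ?I = "\<lambda>n. I [^]\<^bsub>ideals_set R\<^esub> (n::nat)" and ?J = "\<lambda>n. J [^]\<^bsub>ideals_set S\<^esub> (n::nat)"
  let ?a = "\<lambda>n. diff_ops_ideal p e R (?I n)" and ?b = "\<lambda>n. diff_ops_ideal p e S (?J n)"
  note Ii = R.ideal_power_ideal[OF I] and Ji = S.ideal_power_ideal[OF J]
  note Ic = R.ideal_power_carrier[OF I] and Jc = S.ideal_power_carrier[OF J]
  note ai = R.diff_ops_ideal_ideal[OF Ic] and bi = S.diff_ops_ideal_ideal[OF Jc]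
  have U: "?a n \<times> ?b n \<subseteq> X" for n using ideal.Icarr[OF ai] ideal.Icarr[OF bi] by blast
  have D: "diff_ops_ideal p e Q (tensor_span (?I n \<times> ?J n)) = tensor_span (?a n \<times> ?b n)" for n
    using diff_ops_ideal_tensor_span[of "\<lambda>_. ?I n" "\<lambda>_. ?J n" e "{()}"] Ii Ji by simp
  have nu: "n \<in> nu_invariants p Q (product_ideal p R S I J) e \<longleftrightarrow>
      \<not> tensor_span (?I n \<times> ?J n) \<subseteq> tensor_span (?a (Suc n) \<times> ?b (Suc n))" for n
    unfolding Q.nu_invariants_iff[OF product_ideal_ideal[OF I J]] product_ideal_power[OF I J] D ..
  have as: "subgroup (?a n) (add_monoid R)" and bs: "subgroup (?b n) (add_monoid S)" for n
    by (rule ideal_add_subgroup[OF ai], rule ideal_add_subgroup[OF bi])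
  have zs: "subgroup {\<zero>\<^bsub>R\<^esub>} (add_monoid R)" "subgroup {\<zero>\<^bsub>S\<^esub>} (add_monoid S)"
    by (rule ideal_add_subgroup[OF R.zeroideal], rule ideal_add_subgroup[OF S.zeroideal])
  show ?thesis
  proof (intro equalityI subsetI)
    fix n assume "n \<in> nu_invariants p Q (product_ideal p R S I J) e"
    then obtain x y where xy: "(x, y) \<in> ?I n \<times> ?J n" "x \<diamondop> y \<notin> tensor_span (?a (Suc n) \<times> ?b (Suc n))"
      using tensor_span_minimal[OF tensor_span_subgroup[OF U[of "Suc n"]], of "?I n \<times> ?J n"] unfolding nu by blast
    then have "x \<notin> ?a (Suc n) \<or> y \<notin> ?b (Suc n)"
      using tensor_span_incl[of x y "?a (Suc n) \<times> ?b (Suc n)"] by blast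
    then show "n \<in> nu_invariants p R I e \<union> nu_invariants p S J e"
      unfolding Un_iff R.nu_invariants_iff[OF I] S.nu_invariants_iff[OF J] using xy(1) by blast
  next
    fix n assume "n \<in> nu_invariants p R I e \<union> nu_invariants p S J e"
    then show "n \<in> nu_invariants p Q (product_ideal p R S I J) e"
    proof
      assume "n \<in> nu_invariants p R I e"
      then obtain x where x: "x \<in> ?I n" "x \<notin> ?a (Suc n)" unfolding R.nu_invariants_iff[OF I] by blast
      obtain y where y: "y \<in> ?J n" "y \<notin> {\<zero>\<^bsub>S\<^esub>}" using nJ by blast
      \<comment> \<open>The partner \<open>y\<close> is separated from the zero subgroup instead of
        from D J^(n+1): all generators of the span have their first factor in D I^(n+1), so it is
        enough that \<open>y\<close> is nonzero.\<close>
      have "x \<diamondop> y \<notin> tensor_span (?a (Suc n) \<times> ?b (Suc n))"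
        by (rule pure_notin_span[OF U as zs(2) _ x(2) _ y(2)]) (use subsetD[OF Ic x(1)] subsetD[OF Jc y(1)] in simp_all)
      moreover have "x \<diamondop> y \<in> tensor_span (?I n \<times> ?J n)" using x(1) y(1) by (intro tensor_span_incl SigmaI)
      ultimately show ?thesis unfolding nu by blast
    next
      assume "n \<in> nu_invariants p S J e"
      then obtain y where y: "y \<in> ?J n" "y \<notin> ?b (Suc n)" unfolding S.nu_invariants_iff[OF J] by blast
      obtain x where x: "x \<in> ?I n" "x \<notin> {\<zero>\<^bsub>R\<^esub>}" using nI by blast
      have "x \<diamondop> y \<notin> tensor_span (?a (Suc n) \<times> ?b (Suc n))"
        by (rule pure_notin_span[OF U zs(1) bs _ x(2) _ y(2)]) (use subsetD[OF Ic x(1)] subsetD[OF Jc y(1)] in simp_all)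
      moreover have "x \<diamondop> y \<in> tensor_span (?I n \<times> ?J n)" using x(1) y(1) by (intro tensor_span_incl SigmaI)
      ultimately show ?thesis unfolding nu by blast
    qed
  qed
qed

end

section \<open>From the level sets to the Bernstein-Sato roots\<close>

theorem theorem3:
  fixes p :: nat
    and R :: "('a, 'm) ring_scheme" and S :: "('b, 'n) ring_scheme"
    and I :: "'a set" and J :: "'b set"
  assumes "prime p"
    and "regular_ring R" and "has_characteristic R p" and "F_finite p R"
    and "regular_ring S" and "has_characteristic S p" and "F_finite p S"
    and "ideal I R" and "ideal J S"
  shows "(\<forall>z\<in>carrier (padic_ints p).
            z \<in> BS_roots p (tensor_ring p R S) (sum_ideal p R S I J) \<longleftrightarrow>
            (\<exists>x\<in>BS_roots p R I. \<exists>y\<in>BS_roots p S J. z = x \<oplus>\<^bsub>padic_ints p\<^esub> y)) \<and>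
         (\<not> I \<subseteq> nilradical R \<longrightarrow> \<not> J \<subseteq> nilradical S \<longrightarrow>
            BS_roots p (tensor_ring p R S) (product_ideal p R S I J) = BS_roots p R I \<union> BS_roots p S J)"
proof -
  interpret tensor p R S
    by (rule tensor.intro) (use assms in \<open>auto simp: F_finite_def has_characteristic_def\<close>)
  note I = \<open>ideal I R\<close> and J = \<open>ideal J S\<close>
  note roots = BS_roots_eq_level_roots[OF R I, of p] BS_roots_eq_level_roots[OF S J, of p]
  note mono = R.nu_invariants_antimono[OF I, of _ _ p] S.nu_invariants_antimono[OF J, of _ _ p]
  have "BS_roots p Q (sum_ideal p R S I J) =
      level_roots p (\<lambda>e. {n + m | n m. n \<in> nu_invariants p R I e \<and> m \<in> nu_invariants p S J e})"
    unfolding BS_roots_eq_level_roots[OF Q_cring sum_ideal_ideal[OF I J]]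
    using nu_invariants_sum_ideal[OF I J] by presburger
  moreover have "BS_roots p Q (product_ideal p R S I J) = BS_roots p R I \<union> BS_roots p S J"
    if "\<not> I \<subseteq> nilradical R" "\<not> J \<subseteq> nilradical S"
  proof -
    have "nu_invariants p Q (product_ideal p R S I J) = (\<lambda>e. nu_invariants p R I e \<union> nu_invariants p S J e)"
      using nu_invariants_product_ideal[OF I J R.ideal_power_nonzero[OF I that(1)] S.ideal_power_nonzero[OF J that(2)]]
      by blast
    then show ?thesis
      unfolding BS_roots_eq_level_roots[OF Q_cring product_ideal_ideal[OF I J]] roots
      using level_roots_Un[OF mono] by simp
  qed
  ultimately show ?thesis
    using level_roots_sum[OF prime_gt_0_nat[OF \<open>prime p\<close>] mono] unfolding roots by simp
qed

end
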